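(* Let $D=(V,A)$ be a digraph such that there exist no two distinct vertices $u,v$ with both $(u,v)\in A$ and $(v,u)\in A$. (a) $U_D$ is $p$-positive: $U_D\in\mathbb{N}[p_1,p_2,p_3,\dots]$. (b) Call a rotation-equivalence class $\gamma$ of nonempty tuples of elements of $V$ risky if its length is even and either $\gamma$ or the reversal of $\gamma$ is a $D$-cycle. Then \[U_D=\sum_{\substack{\sigma\in\mathfrak{S}_V(D,\overline{D});\\ \text{no cycle of }\sigma\text{ is risky}}}p_{\operatorname{type}\sigma}.\]
   Context: A digraph is $D=(V,A)$ with $V$ finite, $A\subseteq V\times V$; $\overline{D}=(V,(V\times V)\setminus A)$; $n=|V|$. A $V$-listing is a tuple $w=(w_1,\dots,w_n)$ containing each element of $V$ exactly once; $\operatorname{Des}(w,D)=\{i\in[n-1]:(w_i,w_{i+1})\in A\}$; $L_{I,n}=\sum x_{i_1}\cdots x_{i_n}$ over positive integers $i_1\le\cdots\le i_n$ with $i_p<i_{p+1}$ for $p\in I$; $U_D=\sum_w L_{\operatorname{Des}(w,D),n}$ over all $V$-listings. Two nonempty tuples are rotation-equivalent if one is a cyclic rotation of the other; the length of a class is that of its tuples; the reversal of the class of $(v_1,\dots,v_k)$ is the class of $(v_k,\dots,v_1)$; $\operatorname{CArcs}$ of that class is $\{(v_1,v_2),\dots,(v_{k-1},v_k),(v_k,v_1)\}$. A $D$-cycle is a rotation-equivalence class $\gamma$ of nonempty tuples of distinct elements of $V$ with $\operatorname{CArcs}\gamma\subseteq A$ (analogously $\overline{D}$-cycle). The cycles of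 $\sigma\in\mathfrak{S}_V$ are the classes of $(i,\sigma(i),\dots,\sigma^{k-1}(i))$ with $k$ minimal such that $\sigma^k(i)=i$. $\mathfrak{S}_V(D,\overline{D})$ is the set of $\sigma\in\mathfrak{S}_V$ all of whose cycles are $D$-cycles or $\overline{D}$-cycles. $\operatorname{type}\sigma$ is the partition of cycle lengths; $p_k=\sum_i x_i^k$, $p_\lambda=\prod_j p_{\lambda_j}$. *)

theory Defs
  imports
    "HOL-Library.Multiset"
    "HOL-Combinatorics.Multiset_Permutations"
    "HOL-Combinatorics.Cycles"
    "Graph_Theory.Pair_Digraph"
begin

section \<open>Formal power series in arbitrarily many commuting variables\<close>

text \<open>
  A monomial in variables indexed by \<^typ>\<open>'v\<close> is the multiset of its variables;
  a formal power series assigns a coefficient to every monomial.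
\<close>

typedef ('v, 'a) mfps = "UNIV :: ('v multiset \<Rightarrow> 'a) set"
  morphisms mcoeff MFPS
  by simp

setup_lifting type_definition_mfps

lemma mfps_eqI: "(\<And>m. mcoeff f m = mcoeff g m) \<Longrightarrow> f = g"
  by (metis ext mcoeff_inject)

lemma finite_mset_splits: "finite {(a, b). a + b = (m :: 'v multiset)}"
proof (induction m)
  case empty
  have "{(a, b). a + b = ({#} :: 'v multiset)} = {({#}, {#})}" by auto
  then show ?case by simp
next
  case (add x m)
  let ?S = "{(a, b). a + b = m}"
  have "{(a, b). a + b = add_mset x m} \<subseteq>
      (\<lambda>(a, b). (add_mset x a, b)) ` ?S \<union> (\<lambda>(a, b). (a, add_mset x b)) ` ?S"
  proof (rule subsetI)
    fix p assume "p \<in> {(a, b). a + b = add_mset x m}"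
    then obtain a b where p: "p = (a, b)" and ab: "a + b = add_mset x m" by auto
    then have "x \<in># a \<or> x \<in># b" by (metis union_iff union_single_eq_member)
    then show "p \<in> (\<lambda>(a, b). (add_mset x a, b)) ` ?S \<union> (\<lambda>(a, b). (a, add_mset x b)) ` ?S"
    proof
      assume "x \<in># a"
      then obtain a' where "a = add_mset x a'" by (metis insert_DiffM)
      with ab p show ?thesis by force
    next
      assume "x \<in># b"
      then obtain b' where "b = add_mset x b'" by (metis insert_DiffM)
      with ab p show ?thesis by force
    qed
  qed
  with add.IH show ?case by (meson finite_UnI finite_imageI finite_subset)
qed

instantiation mfps :: (type, comm_ring_1) comm_ring_1
begin

lift_definition zero_mfps :: "('a, 'b) mfps" is "\<lambda>_. 0" .
lift_definition one_mfps :: "('a, 'b) mfps" is "\<lambda>m. if m = {#} then 1 else 0" .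
lift_definition plus_mfps :: "('a, 'b) mfps \<Rightarrow> ('a, 'b) mfps \<Rightarrow> ('a, 'b) mfps"
  is "\<lambda>f g m. f m + g m" .
lift_definition minus_mfps :: "('a, 'b) mfps \<Rightarrow> ('a, 'b) mfps \<Rightarrow> ('a, 'b) mfps"
  is "\<lambda>f g m. f m - g m" .
lift_definition uminus_mfps :: "('a, 'b) mfps \<Rightarrow> ('a, 'b) mfps"
  is "\<lambda>f m. - f m" .
lift_definition times_mfps :: "('a, 'b) mfps \<Rightarrow> ('a, 'b) mfps \<Rightarrow> ('a, 'b) mfps"
  is "\<lambda>f g m. \<Sum>(a, b)\<in>{(a, b). a + b = m}. f a * g b" .

instance
proof
  fix f g h :: "('a, 'b) mfps"
  show "f * g * h = f * (g * h)"
  proof (rule mfps_eqI)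
    fix m :: "'a multiset"
    let ?S = "\<lambda>m. {(a, b). a + b = (m :: 'a multiset)}"
    let ?T = "{(a, b, c). a + b + c = m}"
    have "mcoeff (f * g * h) m =
        (\<Sum>(d, c)\<in>?S m. \<Sum>(a, b)\<in>?S d. mcoeff f a * mcoeff g b * mcoeff h c)"
      by (simp add: times_mfps.rep_eq sum_distrib_right case_prod_unfold)
    also have "\<dots> = (\<Sum>p\<in>Sigma (?S m) (\<lambda>p. ?S (fst p)).
        mcoeff f (fst (snd p)) * mcoeff g (snd (snd p)) * mcoeff h (snd (fst p)))"
      by (simp add: sum.Sigma case_prod_unfold finite_mset_splits[unfolded case_prod_unfold])
    also have "\<dots> = (\<Sum>(a, b, c)\<in>?T. mcoeff f a * mcoeff g b * mcoeff h c)"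
      by (rule sum.reindex_bij_witness
          [where i = "\<lambda>(a, b, c). ((a + b, c), (a, b))"
            and j = "\<lambda>((d, c), (a, b)). (a, b, c)"]) auto
    also have "\<dots> = (\<Sum>p\<in>Sigma (?S m) (\<lambda>p. ?S (snd p)).
        mcoeff f (fst (fst p)) * (mcoeff g (fst (snd p)) * mcoeff h (snd (snd p))))"
      by (rule sum.reindex_bij_witness
          [where j = "\<lambda>(a, b, c). ((a, b + c), (b, c))"
            and i = "\<lambda>((a, d), (b, c)). (a, b, c)"]) (auto simp: add.assoc mult.assoc)
    also have "\<dots> =
        (\<Sum>(a, d)\<in>?S m. \<Sum>(b, c)\<in>?S d. mcoeff f a * (mcoeff g b * mcoeff h c))"
      by (simp add: sum.Sigma case_prod_unfold finite_mset_splits[unfolded case_prod_unfold])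
    also have "\<dots> = mcoeff (f * (g * h)) m"
      by (simp add: times_mfps.rep_eq sum_distrib_left case_prod_unfold)
    finally show "mcoeff (f * g * h) m = mcoeff (f * (g * h)) m" .
  qed
  show "f * g = g * f"
  proof (rule mfps_eqI)
    fix m
    show "mcoeff (f * g) m = mcoeff (g * f) m"
      unfolding times_mfps.rep_eq
      by (rule sum.reindex_bij_witness[where i = prod.swap and j = prod.swap])
        (auto simp: add.commute mult.commute)
  qed
  show "1 * f = f"
  proof (rule mfps_eqI)
    fix m
    have "mcoeff (1 * f) m = (\<Sum>p\<in>{(a, b). a + b = m}. if p = ({#}, m) then mcoeff f m else 0)"
      unfolding times_mfps.rep_eq one_mfps.rep_eq by (rule sum.cong) (auto split: if_splits)
    also have "\<dots> = mcoeff f m"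
      by (simp add: sum.delta' finite_mset_splits)
    finally show "mcoeff (1 * f) m = mcoeff f m" .
  qed
  show "(f + g) * h = f * h + g * h"
    by (rule mfps_eqI)
      (simp add: times_mfps.rep_eq plus_mfps.rep_eq distrib_right case_prod_unfold sum.distrib)
  show "(0 :: ('a, 'b) mfps) \<noteq> 1"
    by transfer (metis zero_neq_one)
qed (transfer; auto simp: fun_eq_iff algebra_simps)+

end

lift_definition mvar :: "'v \<Rightarrow> ('v, 'a::comm_ring_1) mfps"
  is "\<lambda>i m. if m = {#i#} then 1 else 0" .

text \<open>
  Infinite sums are taken coefficientwise. The sum is meaningful if for every monomial
  only finitely many members of the family have a nonzero coefficient.
\<close>

definition msummable :: "('i \<Rightarrow> ('v, 'a::comm_ring_1) mfps) \<Rightarrow> 'i set \<Rightarrow> bool" where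
  "msummable f S \<longleftrightarrow> (\<forall>m. finite {i \<in> S. mcoeff (f i) m \<noteq> 0})"

lift_definition msum :: "('i \<Rightarrow> ('v, 'a::comm_ring_1) mfps) \<Rightarrow> 'i set \<Rightarrow> ('v, 'a) mfps"
  is "\<lambda>f S m. \<Sum>i\<in>{i \<in> S. f i m \<noteq> 0}. f i m" .

lemma mcoeff_prod_mvar:
  "mcoeff (\<Prod>i\<leftarrow>xs. mvar i :: ('v, 'a::comm_ring_1) mfps) m = (if m = mset xs then 1 else 0)"
proof (induction xs arbitrary: m)
  case Nil
  then show ?case by (simp add: one_mfps.rep_eq)
next
  case (Cons x xs)
  have "mcoeff (\<Prod>i\<leftarrow>x # xs. mvar i :: ('v, 'a) mfps) m =
      (\<Sum>p\<in>{(a, b). a + b = m}. if p = ({#x#}, mset xs) then 1 else 0)"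
    using Cons.IH
    by (auto simp: times_mfps.rep_eq mvar.rep_eq intro!: sum.cong)
  also have "\<dots> = (if m = mset (x # xs) then 1 else 0)"
    by (auto simp: sum.delta' finite_mset_splits)
  finally show ?case .
qed

section \<open>Power sums and fundamental quasisymmetric functions\<close>

text \<open>The variables are those \<^term>\<open>mvar i\<close> with \<^term>\<open>i \<ge> (1::nat)\<close>.\<close>

definition powersum :: "nat \<Rightarrow> (nat, int) mfps" where
  "powersum k = msum (\<lambda>i. mvar i ^ k) {1..}"

text \<open>Partitions are represented by the multisets of their parts.\<close>

definition powersum_partition :: "nat multiset \<Rightarrow> (nat, int) mfps" where
  "powersum_partition la = (\<Prod>k\<in>#la. powersum k)"

text \<open>
  \<open>\<nat>[p\<^sub>1, p\<^sub>2, \<dots>]\<close>, the subsemiring generated by the power sums.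
\<close>

inductive_set powersum_semiring :: "(nat, int) mfps set" where
  zero: "0 \<in> powersum_semiring"
| one: "1 \<in> powersum_semiring"
| gen: "k \<ge> 1 \<Longrightarrow> powersum k \<in> powersum_semiring"
| add: "f \<in> powersum_semiring \<Longrightarrow> g \<in> powersum_semiring \<Longrightarrow> f + g \<in> powersum_semiring"
| mult: "f \<in> powersum_semiring \<Longrightarrow> g \<in> powersum_semiring \<Longrightarrow> f * g \<in> powersum_semiring"

text \<open>
  The entry \<open>i\<^sub>p\<close> of a tuple \<open>(i\<^sub>1, \<dots>, i\<^sub>n)\<close> is \<^term>\<open>is ! (p - 1)\<close>.
\<close>

definition fundamental_indices :: "nat set \<Rightarrow> nat \<Rightarrow> nat list set" where
  "fundamental_indices I n =
    {is. length is = n \<and> (\<forall>i\<in>set is. 1 \<le> i) \<and> sorted is \<and> (\<forall>p\<in>I. is ! (p - 1) < is ! p)}"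

definition fundamental :: "nat set \<Rightarrow> nat \<Rightarrow> (nat, int) mfps" where
  "fundamental I n = msum (\<lambda>is. \<Prod>i\<leftarrow>is. mvar i) (fundamental_indices I n)"

lemma msummable_powersum:
  assumes "k \<ge> 1"
  shows "msummable (\<lambda>i. mvar i ^ k :: (nat, int) mfps) {1..}"
  unfolding msummable_def
proof
  fix m
  have "mcoeff (mvar i ^ k :: (nat, int) mfps) m = (if m = mset (replicate k i) then 1 else 0)" for i
    using mcoeff_prod_mvar[of "replicate k i" m]
    by (simp add: map_replicate prod_list_replicate del: mset_replicate)
  then have "{i \<in> {1..}. mcoeff (mvar i ^ k :: (nat, int) mfps) m \<noteq> 0} \<subseteq> set_mset m"
    using assms by (auto split: if_splits)
  then show "finite {i \<in> {1..}. mcoeff (mvar i ^ k :: (nat, int) mfps) m \<noteq> 0}"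
    by (rule finite_subset) simp
qed

lemma msummable_fundamental:
  "msummable (\<lambda>is. \<Prod>i\<leftarrow>is. mvar i :: (nat, int) mfps) (fundamental_indices I n)"
  unfolding msummable_def
proof
  fix m :: "nat multiset"
  have "{is \<in> fundamental_indices I n. mcoeff (\<Prod>i\<leftarrow>is. mvar i :: (nat, int) mfps) m \<noteq> 0}
      \<subseteq> {is. mset is = m}"
    by (auto simp: mcoeff_prod_mvar split: if_splits)
  moreover have "{is. mset is = m} = permutations_of_multiset m"
    by (simp add: permutations_of_multiset_def)
  ultimately show "finite {is \<in> fundamental_indices I n.
      mcoeff (\<Prod>i\<leftarrow>is. mvar i :: (nat, int) mfps) m \<noteq> 0}"
    by (metis finite_permutations_of_multiset finite_subset)
qed

section \<open>The Redei--Berge symmetric function\<close>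

definition complement_digraph :: "'a pair_pre_digraph \<Rightarrow> 'a pair_pre_digraph" where
  "complement_digraph D =
    \<lparr> pverts = pverts D, parcs = (pverts D \<times> pverts D) - parcs D \<rparr>"

definition Des :: "'a list \<Rightarrow> 'a pair_pre_digraph \<Rightarrow> nat set" where
  "Des w D = {i \<in> {1..length w - 1}. (w ! (i - 1), w ! i) \<in> parcs D}"

text \<open>The \<open>V\<close>-listings are the elements of \<^term>\<open>permutations_of_set V\<close>.\<close>

definition redei_berge :: "'a pair_pre_digraph \<Rightarrow> (nat, int) mfps" where
  "redei_berge D =
    (\<Sum>w\<in>permutations_of_set (pverts D). fundamental (Des w D) (card (pverts D)))"

section \<open>Rotation-equivalence classes\<close>

definition rot_equiv :: "('a list \<times> 'a list) set" where
  "rot_equiv = {(v, w). v \<noteq> [] \<and> w \<noteq> [] \<and> (\<exists>k. w = rotate k v)}"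

lemma equiv_rot_equiv: "equiv {v :: 'a list. v \<noteq> []} rot_equiv"
proof (rule equivI)
  show "rot_equiv \<subseteq> {v :: 'a list. v \<noteq> []} \<times> {v. v \<noteq> []}"
    by (auto simp: rot_equiv_def)
  show "refl_on {v :: 'a list. v \<noteq> []} rot_equiv"
    by (auto simp: rot_equiv_def refl_on_def intro: exI[of _ 0])
  show "sym (rot_equiv :: ('a list \<times> _) set)"
  proof (rule symI)
    fix v w :: "'a list"
    assume "(v, w) \<in> rot_equiv"
    then obtain k where ne: "v \<noteq> []" "w \<noteq> []" and w: "w = rotate k v"
      by (auto simp: rot_equiv_def)
    have "rotate (length v - k mod length v) w =
        rotate (length v - k mod length v) (rotate (k mod length v) v)"
      using w by (metis rotate_conv_mod)
    also have "\<dots> = v"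
      using ne by (simp add: rotate_rotate order_less_imp_le)
    finally show "(w, v) \<in> rot_equiv"
      using ne by (auto simp: rot_equiv_def intro: sym)
  qed
  show "trans (rot_equiv :: ('a list \<times> _) set)"
    by (rule transI) (auto simp: rot_equiv_def rotate_rotate)
qed

definition rot_class :: "'a list \<Rightarrow> 'a list set" where
  "rot_class v = rot_equiv `` {v}"

text \<open>
  The notions for classes are defined through an arbitrary representative;
  the lemmas below show independence of the choice.
\<close>

definition rot_rep :: "'a list set \<Rightarrow> 'a list" where
  "rot_rep \<gamma> = (SOME v. v \<in> \<gamma>)"

definition rot_length :: "'a list set \<Rightarrow> nat" where
  "rot_length \<gamma> = length (rot_rep \<gamma>)"

definition rot_reversal :: "'a list set \<Rightarrow> 'a list set" where
  "rot_reversal \<gamma> = rot_class (rev (rot_rep \<gamma>))"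

definition CArcs :: "'a list set \<Rightarrow> ('a \<times> 'a) set" where
  "CArcs \<gamma> = set (zip (rot_rep \<gamma>) (rotate1 (rot_rep \<gamma>)))"

lemma rot_rep_rot_class:
  assumes "v \<noteq> []"
  shows "(v, rot_rep (rot_class v)) \<in> rot_equiv"
proof -
  have "v \<in> rot_class v"
    using assms by (auto simp: rot_class_def rot_equiv_def intro: exI[of _ 0])
  then have "rot_rep (rot_class v) \<in> rot_class v"
    unfolding rot_rep_def by (rule someI)
  then show ?thesis by (simp add: rot_class_def)
qed

lemma rot_length_rot_class: "v \<noteq> [] \<Longrightarrow> rot_length (rot_class v) = length v"
  using rot_rep_rot_class[of v] by (auto simp: rot_length_def rot_equiv_def)

lemma rot_reversal_rot_class:
  assumes "v \<noteq> []"
  shows "rot_reversal (rot_class v) = rot_class (rev v)"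
proof -
  obtain k where k: "rot_rep (rot_class v) = rotate k v"
    using rot_rep_rot_class[OF assms] by (auto simp: rot_equiv_def)
  have "rev v = rotate k (rev (rotate k v))"
  proof -
    have "rotate k (rev (rotate k v)) = rev v" for v :: "'a list"
    proof (induction k arbitrary: v)
      case (Suc k)
      have "rotate (Suc k) (rev (rotate (Suc k) v)) = rotate1 (rotate k (rev (rotate k (rotate1 v))))"
        by (simp add: rotate1_rotate_swap)
      also have "\<dots> = rotate1 (rev (rotate1 v))" by (simp add: Suc.IH)
      also have "\<dots> = rev v" by (cases v) auto
      finally show ?case .
    qed simp
    then show ?thesis by simp
  qed
  then have "(rev (rotate k v), rev v) \<in> rot_equiv"
    using assms by (auto simp: rot_equiv_def)
  then show ?thesis
    unfolding rot_reversal_def k unfolding rot_class_def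
    by (rule equiv_class_eq[OF equiv_rot_equiv])
qed

lemma CArcs_rot_class:
  assumes "v \<noteq> []"
  shows "CArcs (rot_class v) = set (zip v (rotate1 v))"
proof -
  obtain k where k: "rot_rep (rot_class v) = rotate k v"
    using rot_rep_rot_class[OF assms] by (auto simp: rot_equiv_def)
  have "zip (rotate k v) (rotate1 (rotate k v)) = rotate k (zip v (rotate1 v))"
    by (rule nth_equalityI)
      (use assms in \<open>auto simp: nth_rotate nth_rotate1 mod_simps\<close>)
  then show ?thesis
    by (simp add: CArcs_def k)
qed

section \<open>Cycles of digraphs and permutations\<close>

definition is_digraph_cycle :: "'a pair_pre_digraph \<Rightarrow> 'a list set \<Rightarrow> bool" where
  "is_digraph_cycle D \<gamma> \<longleftrightarrow>
    (\<exists>v. v \<noteq> [] \<and> distinct v \<and> set v \<subseteq> pverts D \<and> \<gamma> = rot_class v) \<and> CArcs \<gamma> \<subseteq> parcs D"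

text \<open>
  A permutation \<open>\<sigma>\<close> of \<open>V\<close> is a function with \<^term>\<open>\<sigma> permutes V\<close>; its cycles are
  those through elements of \<open>V\<close>, with fixed points in \<open>V\<close> giving cycles of length 1.
  \<^term>\<open>support \<sigma> i\<close> is the tuple \<open>(i, \<sigma> i, \<dots>, \<sigma>\<^sup>k\<^sup>-\<^sup>1 i)\<close> with \<open>k\<close> minimal
  such that \<open>\<sigma>\<^sup>k i = i\<close>.
\<close>

definition perm_cycles :: "'a set \<Rightarrow> ('a \<Rightarrow> 'a) \<Rightarrow> 'a list set set" where
  "perm_cycles V \<sigma> = (\<lambda>i. rot_class (support \<sigma> i)) ` V"

definition perm_type :: "'a set \<Rightarrow> ('a \<Rightarrow> 'a) \<Rightarrow> nat multiset" where
  "perm_type V \<sigma> = image_mset rot_length (mset_set (perm_cycles V \<sigma>))"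

definition cycle_perms :: "'a pair_pre_digraph \<Rightarrow> ('a \<Rightarrow> 'a) set" where
  "cycle_perms D = {\<sigma>. \<sigma> permutes pverts D \<and>
    (\<forall>\<gamma>\<in>perm_cycles (pverts D) \<sigma>.
      is_digraph_cycle D \<gamma> \<or> is_digraph_cycle (complement_digraph D) \<gamma>)}"

definition risky :: "'a pair_pre_digraph \<Rightarrow> 'a list set \<Rightarrow> bool" where
  "risky D \<gamma> \<longleftrightarrow> even (rot_length \<gamma>) \<and>
    (is_digraph_cycle D \<gamma> \<or> is_digraph_cycle D (rot_reversal \<gamma>))"

end

theory Submission
  imports Defs "HOL-Combinatorics.Orbits"
begin

text \<open>
  Fix a labelling \<open>f\<close> of the vertices by positive integers. Its contribution to \<open>U\<^sub>D\<close> is the number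
  of listings along which \<open>f\<close> weakly increases and which use no arc of \<open>D\<close> inside a level of \<open>f\<close>. By
  inclusion-exclusion this is an alternating sum over arc sets \<open>F\<close> inside the levels, and if \<open>F\<close> is
  acyclic, there are as many \<open>f\<close>-sorted listings through \<open>F\<close> as permutations \<open>\<sigma>\<close> with \<open>f \<circ> \<sigma> = f\<close>
  whose graph contains \<open>F\<close>. Exchanging the sums, each \<open>\<sigma>\<close> gets the weight \<open>\<Sum> (-1)^card F\<close>, where
  \<open>F\<close> ranges over the acyclic sets of arcs of \<open>D\<close> in the graph of \<open>\<sigma>\<close>. It is a product over the
  cycles of \<open>\<sigma>\<close>, with factor \<open>(-1)^(k-1)\<close> for a \<open>D\<close>-cycle of length \<open>k\<close>, factor \<open>1\<close> for a cycle
  of the complement and factor \<open>0\<close> otherwise. The labellings invariant under \<open>\<sigma>\<close> sum up to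
  \<open>p\<^bsub>type \<sigma>\<^esub>\<close>, so \<open>U\<^sub>D\<close> is the weighted sum of these power sums over all \<open>\<sigma>\<close>, for every digraph.
  Without antiparallel arcs, reversing a risky cycle changes the sign of the weight, so only the
  permutations without risky cycles survive, with weight \<open>1\<close>.
\<close>

section \<open>Generating series of weighted families\<close>

definition finite_fibres :: "'i set \<Rightarrow> ('i \<Rightarrow> 'b) \<Rightarrow> bool" where
  "finite_fibres S wt \<longleftrightarrow> (\<forall>m. finite {i \<in> S. wt i = m})"

definition genseries :: "'i set \<Rightarrow> ('i \<Rightarrow> 'v multiset) \<Rightarrow> ('v, 'r::comm_ring_1) mfps" where
  "genseries S wt = msum (\<lambda>i. \<Prod>x\<in>#wt i. mvar x) S"

lemma mcoeff_zero [simp]: "mcoeff 0 m = 0"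
  by (simp add: zero_mfps.rep_eq)

lemma mcoeff_sum: "mcoeff (\<Sum>x\<in>S. F x) m = (\<Sum>x\<in>S. mcoeff (F x) m)"
  by (induction S rule: infinite_finite_induct) (simp_all add: plus_mfps.rep_eq)

lemma mcoeff_of_int_mult: "mcoeff (of_int c * f) m = of_int c * mcoeff f m"
proof -
  have "mcoeff (of_nat n * f) m = of_nat n * mcoeff f m" for n
    by (induction n) (simp_all add: distrib_right plus_mfps.rep_eq)
  then show ?thesis
    by (cases c rule: int_cases2) (simp_all add: uminus_mfps.rep_eq)
qed

lemma mfps_eq_uminus_self_iff: "f = - f \<longleftrightarrow> f = 0" for f :: "('v, 'a::linordered_idom) mfps"
  by transfer (simp add: fun_eq_iff)

lemma mcoeff_genseries:
  fixes wt :: "'i \<Rightarrow> 'v multiset"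
  shows "mcoeff (genseries S wt :: ('v, 'r::comm_ring_1) mfps) m = of_nat (card {i \<in> S. wt i = m})"
proof -
  have monomial: "mcoeff (\<Prod>x\<in>#a. mvar x :: ('v, 'r) mfps) m = (if a = m then 1 else 0)" for a
  proof -
    obtain xs where "a = mset xs" by (metis ex_mset)
    then show ?thesis using mcoeff_prod_mvar[of xs m] by (auto simp flip: prod_mset_prod_list)
  qed
  then have "{i \<in> S. mcoeff (\<Prod>x\<in>#wt i. mvar x :: ('v, 'r) mfps) m \<noteq> 0} = {i \<in> S. wt i = m}"
    by auto
  then have "mcoeff (genseries S wt :: ('v, 'r) mfps) m = (\<Sum>i | i \<in> S \<and> wt i = m. 1)"
    by (simp add: genseries_def msum.rep_eq monomial)
  then show ?thesis by simp
qed

lemma genseries_reindex: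
  assumes "bij_betw h S T" "\<And>i. i \<in> S \<Longrightarrow> wt' (h i) = wt i"
  shows "genseries S wt = genseries T wt'"
proof (rule mfps_eqI)
  fix m
  have "bij_betw h {i \<in> S. wt i = m} {j \<in> T. wt' j = m}"
    using assms by (intro bij_betw_Collect) auto
  then show "mcoeff (genseries S wt) m = mcoeff (genseries T wt') m"
    unfolding mcoeff_genseries by (simp add: bij_betw_same_card)
qed

lemma genseries_mult:
  fixes wt :: "'i \<Rightarrow> 'v multiset" and wt' :: "'j \<Rightarrow> 'v multiset"
  assumes "finite_fibres S wt" "finite_fibres T wt'"
  shows "(genseries S wt * genseries T wt' :: ('v, 'r::comm_ring_1) mfps) =
    genseries (S \<times> T) (\<lambda>(i, j). wt i + wt' j)"
proof (rule mfps_eqI)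
  fix m :: "'v multiset"
  let ?fibre = "\<lambda>(a, b). {i \<in> S. wt i = a} \<times> {j \<in> T. wt' j = b}"
  let ?splits = "{(a, b). a + b = m}"
  have fin: "finite (?fibre p)" for p
    using assms by (simp add: finite_fibres_def split: prod.split)
  have "mcoeff (genseries S wt * genseries T wt' :: ('v, 'r) mfps) m =
      of_nat (\<Sum>p\<in>?splits. card (?fibre p))"
    by (simp add: times_mfps.rep_eq mcoeff_genseries card_cartesian_product case_prod_unfold)
  also have "(\<Sum>p\<in>?splits. card (?fibre p)) = card (\<Union>(?fibre ` ?splits))"
    by (rule card_UN_disjoint[symmetric]) (use finite_mset_splits fin in auto)
  also have "\<Union>(?fibre ` ?splits) = {p \<in> S \<times> T. (\<lambda>(i, j). wt i + wt' j) p = m}"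
    by auto
  finally show "mcoeff (genseries S wt * genseries T wt' :: ('v, 'r) mfps) m =
      mcoeff (genseries (S \<times> T) (\<lambda>(i, j). wt i + wt' j)) m"
    by (simp add: mcoeff_genseries)
qed

lemma finite_fibres_PiE:
  fixes wt :: "'i \<Rightarrow> 'j \<Rightarrow> 'v multiset"
  assumes "finite I" "\<And>i. i \<in> I \<Longrightarrow> finite_fibres (S i) (wt i)"
  shows "finite_fibres (Pi\<^sub>E I S) (\<lambda>g. \<Sum>i\<in>I. wt i (g i))"
  unfolding finite_fibres_def
proof
  fix m :: "'v multiset"
  let ?below = "\<lambda>i. \<Union>a\<in>{a. a \<subseteq># m}. {j \<in> S i. wt i j = a}"
  have "finite {a. a \<subseteq># (m :: 'v multiset)}"
  proof (rule finite_surj[OF finite_mset_splits])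
    show "{a. a \<subseteq># m} \<subseteq> fst ` {(a, b). a + b = m}"
      by (auto simp: mset_subset_eq_exists_conv intro: rev_image_eqI)
  qed
  then have "finite (?below i)" if "i \<in> I" for i
    using assms(2)[OF that] by (simp add: finite_fibres_def)
  then have "finite (Pi\<^sub>E I ?below)"
    using assms(1) by (intro finite_PiE)
  moreover have "wt i (g i) \<subseteq># (\<Sum>i\<in>I. wt i (g i))" if "i \<in> I" for i g
    using assms(1) that by (simp add: sum.remove[of I i])
  then have "{g \<in> Pi\<^sub>E I S. (\<Sum>i\<in>I. wt i (g i)) = m} \<subseteq> Pi\<^sub>E I ?below"
    by (auto simp: PiE_iff extensional_def)
  ultimately show "finite {g \<in> Pi\<^sub>E I S. (\<Sum>i\<in>I. wt i (g i)) = m}"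
    by (rule finite_subset[rotated])
qed

lemma prod_genseries:
  fixes wt :: "'i \<Rightarrow> 'j \<Rightarrow> 'v multiset"
  assumes "finite I" "\<And>i. i \<in> I \<Longrightarrow> finite_fibres (S i) (wt i)"
  shows "(\<Prod>i\<in>I. genseries (S i) (wt i) :: ('v, 'r::comm_ring_1) mfps) =
    genseries (Pi\<^sub>E I S) (\<lambda>g. \<Sum>i\<in>I. wt i (g i))"
  using assms
proof (induction I rule: finite_induct)
  case empty
  show ?case by (rule mfps_eqI) (simp add: mcoeff_genseries one_mfps.rep_eq)
next
  case (insert k I)
  have IH: "(\<Prod>i\<in>I. genseries (S i) (wt i) :: ('v, 'r) mfps) =
      genseries (Pi\<^sub>E I S) (\<lambda>g. \<Sum>i\<in>I. wt i (g i))"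
    by (rule insert.IH) (simp add: insert.prems)
  have "(\<Prod>i\<in>insert k I. genseries (S i) (wt i) :: ('v, 'r) mfps) =
      genseries (S k) (wt k) * genseries (Pi\<^sub>E I S) (\<lambda>g. \<Sum>i\<in>I. wt i (g i))"
    using insert.hyps by (simp add: IH)
  also have "\<dots> = genseries (S k \<times> Pi\<^sub>E I S) (\<lambda>(j, g). wt k j + (\<Sum>i\<in>I. wt i (g i)))"
    using insert by (intro genseries_mult finite_fibres_PiE) auto
  also have "\<dots> = genseries (Pi\<^sub>E (insert k I) S) (\<lambda>g. \<Sum>i\<in>insert k I. wt i (g i))"
  proof (rule genseries_reindex)
    show "bij_betw (\<lambda>(j, g). g(k := j)) (S k \<times> Pi\<^sub>E I S) (Pi\<^sub>E (insert k I) S)"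
      unfolding bij_betw_def using insert.hyps by (simp add: inj_combinator PiE_insert_eq)
  next
    fix p assume "p \<in> S k \<times> Pi\<^sub>E I S"
    moreover have "(\<Sum>i\<in>I. wt i ((g(k := j)) i)) = (\<Sum>i\<in>I. wt i (g i))" for j g
      using insert.hyps by (intro sum.cong) auto
    ultimately show "(\<Sum>i\<in>insert k I. wt i ((\<lambda>(j, g). g(k := j)) p i)) =
        (\<lambda>(j, g). wt k j + (\<Sum>i\<in>I. wt i (g i))) p"
      using insert.hyps by (simp add: case_prod_unfold)
  qed
  finally show ?case .
qed

lemma weighted_sum_genseries_eqI:
  fixes c :: "'i \<Rightarrow> int" and d :: "'j \<Rightarrow> int"
  assumes fin: "finite I" "finite J" "finite_fibres S wt"
    and eq: "\<And>x. x \<in> S \<Longrightarrow> (\<Sum>i | i \<in> I \<and> P i x. c i) = (\<Sum>j | j \<in> J \<and> Q j x. d j)"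
  shows "(\<Sum>i\<in>I. of_int (c i) * genseries {x \<in> S. P i x} wt) =
    (\<Sum>j\<in>J. of_int (d j) * genseries {x \<in> S. Q j x} wt)"
proof (rule mfps_eqI)
  fix m
  let ?S = "{x \<in> S. wt x = m}"
  have "finite ?S" using fin(3) by (simp add: finite_fibres_def)
  have coeff: "mcoeff (\<Sum>k\<in>K. of_int (e k) * genseries {x \<in> S. R k x} wt) m =
      of_int (\<Sum>x\<in>?S. \<Sum>k | k \<in> K \<and> R k x. e k)"
    if "finite K" for K :: "'k set" and R and e :: "'k \<Rightarrow> int"
  proof -
    have "mcoeff (\<Sum>k\<in>K. of_int (e k) * genseries {x \<in> S. R k x} wt) m =
        of_int (\<Sum>k\<in>K. e k * card {x \<in> ?S. R k x})"
      by (simp add: mcoeff_sum mcoeff_of_int_mult mcoeff_genseries conj_ac cong: conj_cong)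
    also have "(\<Sum>k\<in>K. e k * card {x \<in> ?S. R k x}) = (\<Sum>k\<in>K. \<Sum>x\<in>?S. if R k x then e k else 0)"
      using \<open>finite ?S\<close> by (simp add: mult.commute flip: sum.inter_filter)
    also have "\<dots> = (\<Sum>x\<in>?S. \<Sum>k\<in>K. if R k x then e k else 0)" by (rule sum.swap)
    also have "\<dots> = (\<Sum>x\<in>?S. \<Sum>k | k \<in> K \<and> R k x. e k)"
      using that by (simp flip: sum.inter_filter)
    finally show ?thesis .
  qed
  have "(\<Sum>x\<in>?S. \<Sum>i | i \<in> I \<and> P i x. c i) = (\<Sum>x\<in>?S. \<Sum>j | j \<in> J \<and> Q j x. d j)"
    using eq by (intro sum.cong) auto
  then show "mcoeff (\<Sum>i\<in>I. of_int (c i) * genseries {x \<in> S. P i x} wt) m =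
      mcoeff (\<Sum>j\<in>J. of_int (d j) * genseries {x \<in> S. Q j x} wt) m"
    unfolding coeff[OF fin(1)] coeff[OF fin(2)] by simp
qed

section \<open>Sorted listings and level-preserving permutations through a set of arcs\<close>

definition list_arcs :: "'a list \<Rightarrow> ('a \<times> 'a) set" where
  "list_arcs w = set (zip w (tl w))"

definition perm_arcs :: "('a \<Rightarrow> 'a) \<Rightarrow> 'a set \<Rightarrow> ('a \<times> 'a) set" where
  "perm_arcs \<sigma> S = (\<lambda>x. (x, \<sigma> x)) ` S"

definition sorted_listings :: "'a set \<Rightarrow> ('a \<Rightarrow> 'b::linorder) \<Rightarrow> 'a list set" where
  "sorted_listings V f = {w \<in> permutations_of_set V. sorted (map f w)}"

definition level_perms :: "'a set \<Rightarrow> ('a \<Rightarrow> 'b) \<Rightarrow> ('a \<Rightarrow> 'a) set" where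
  "level_perms V f = {\<sigma>. \<sigma> permutes V \<and> (\<forall>x\<in>V. f (\<sigma> x) = f x)}"

definition listings_through :: "'a set \<Rightarrow> ('a \<Rightarrow> 'b::linorder) \<Rightarrow> ('a \<times> 'a) set \<Rightarrow> 'a list set" where
  "listings_through V f F = {w \<in> sorted_listings V f. F \<subseteq> list_arcs w}"

definition perms_through :: "'a set \<Rightarrow> ('a \<Rightarrow> 'b) \<Rightarrow> ('a \<times> 'a) set \<Rightarrow> ('a \<Rightarrow> 'a) set" where
  "perms_through V f F = {\<sigma> \<in> level_perms V f. F \<subseteq> perm_arcs \<sigma> V}"

lemma list_arcs_simps [simp]:
  "list_arcs [] = {}"
  "list_arcs [x] = {}"
  "list_arcs (x # y # ys) = insert (x, y) (list_arcs (y # ys))"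
  by (auto simp: list_arcs_def)

lemma list_arcs_append_Cons:
  "list_arcs (xs @ x # ys) = list_arcs (xs @ [x]) \<union> list_arcs (x # ys)"
proof (induction xs)
  case (Cons a xs)
  then show ?case by (cases xs) (simp_all add: insert_commute)
qed simp

lemma list_arcs_iff:
  "(x, y) \<in> list_arcs w \<longleftrightarrow> (\<exists>i. Suc i < length w \<and> x = w ! i \<and> y = w ! Suc i)"
  by (auto simp: list_arcs_def in_set_zip nth_tl less_diff_conv)

lemma list_arcs_subset: "list_arcs w \<subseteq> set w \<times> set w"
  by (auto simp: list_arcs_iff)

lemma list_arcs_split:
  assumes "(u, v) \<in> list_arcs w"
  obtains xs ys where "w = xs @ u # v # ys"
proof -
  obtain i where "Suc i < length w" "u = w ! i" "v = w ! Suc i"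
    using assms by (auto simp: list_arcs_iff)
  then have "w = take i w @ u # v # drop (Suc (Suc i)) w"
    by (metis Cons_nth_drop_Suc Suc_lessD append_take_drop_id)
  then show ?thesis using that by blast
qed

lemma single_valued_list_arcs: "distinct w \<Longrightarrow> single_valued (list_arcs w)"
  by (auto simp: single_valued_def list_arcs_iff nth_eq_iff_index_eq)

lemma single_valued_converse_list_arcs: "distinct w \<Longrightarrow> single_valued ((list_arcs w)\<inverse>)"
  by (auto simp: single_valued_def list_arcs_iff nth_eq_iff_index_eq)

lemma acyclic_list_arcs: "distinct w \<Longrightarrow> acyclic (list_arcs w)"
proof (induction w rule: induct_list012)
  case (3 x y ys)
  have "(y, x) \<notin> (list_arcs (y # ys))\<^sup>*"
  proof
    assume "(y, x) \<in> (list_arcs (y # ys))\<^sup>*"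
    then have "x \<in> set (y # ys)"
      using list_arcs_subset[of "y # ys"] by (cases rule: rtranclE) auto
    with 3 show False by simp
  qed
  with 3 show ?case by (simp add: acyclic_insert)
qed (auto simp: acyclic_def)

lemma perm_arcs_iff [simp]: "(x, y) \<in> perm_arcs \<sigma> S \<longleftrightarrow> x \<in> S \<and> y = \<sigma> x"
  by (auto simp: perm_arcs_def)

lemma single_valued_perm_arcs: "single_valued (perm_arcs \<sigma> S)"
  by (simp add: single_valued_def)

lemma single_valued_converse_perm_arcs: "inj_on \<sigma> S \<Longrightarrow> single_valued ((perm_arcs \<sigma> S)\<inverse>)"
  by (auto simp: single_valued_def inj_on_def)

lemma sorted_listings_iff:
  "w \<in> sorted_listings V f \<longleftrightarrow> distinct w \<and> set w = V \<and> sorted (map f w)"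
  by (auto simp: sorted_listings_def permutations_of_set_def)

lemma finite_sorted_listings [simp]: "finite (sorted_listings V f)"
  by (simp add: sorted_listings_def)

lemma finite_level_perms [simp]: "finite V \<Longrightarrow> finite (level_perms V f)"
  using finite_permutations[of V] by (auto simp: level_perms_def)

lemma distinct_lists_obtain_permutes:
  assumes "distinct v" "distinct w" "set v = set w"
  obtains \<sigma> where "\<sigma> permutes set w" "v = map \<sigma> w"
proof -
  have len: "length v = length w" using assms by (metis distinct_card)
  define \<sigma> where "\<sigma> x = (if x \<in> set w then the (map_of (zip w v) x) else x)" for x
  have "\<sigma> (w ! i) = v ! i" if "i < length w" for i
    using that assms len by (auto simp: \<sigma>_def map_of_zip_nth)
  then have v: "v = map \<sigma> w" using len by (auto intro: nth_equalityI)
  have "\<sigma> permutes set w"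
  proof (rule bij_imp_permutes)
    show "bij_betw \<sigma> (set w) (set w)"
      using assms unfolding v bij_betw_def by (simp add: distinct_map)
  qed (simp add: \<sigma>_def)
  with v show ?thesis using that by blast
qed

lemma sorted_listings_eq_image_level_perms:
  assumes "w \<in> sorted_listings V f"
  shows "sorted_listings V f = (\<lambda>\<sigma>. map \<sigma> w) ` level_perms V f"
proof -
  have w: "distinct w" "set w = V" "sorted (map f w)"
    using assms by (simp_all add: sorted_listings_iff)
  show ?thesis
  proof (intro subset_antisym subsetI)
    fix v assume "v \<in> sorted_listings V f"
    then have v: "distinct v" "set v = V" "sorted (map f v)"
      by (simp_all add: sorted_listings_iff)
    obtain \<sigma> where \<sigma>: "\<sigma> permutes V" "v = map \<sigma> w"
      using v w distinct_lists_obtain_permutes by metis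
    have "map f v = map f w"
      using v w by (metis mset_map properties_for_sort set_eq_iff_mset_eq_distinct)
    then have "\<forall>x\<in>V. f (\<sigma> x) = f x" using \<sigma>(2) w(2) by simp
    with \<sigma> show "v \<in> (\<lambda>\<sigma>. map \<sigma> w) ` level_perms V f"
      by (auto simp: level_perms_def)
  next
    fix v assume "v \<in> (\<lambda>\<sigma>. map \<sigma> w) ` level_perms V f"
    then obtain \<sigma> where \<sigma>: "\<sigma> permutes V" "\<forall>x\<in>V. f (\<sigma> x) = f x" "v = map \<sigma> w"
      by (auto simp: level_perms_def)
    then have "map f v = map f w" using w(2) by auto
    moreover have "distinct v" "set v = V"
      using \<sigma> w by (auto simp: distinct_map permutes_inj_on permutes_image)
    ultimately show "v \<in> sorted_listings V f" using w(3) by (simp add: sorted_listings_iff)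
  qed
qed

lemma card_sorted_listings:
  assumes "finite V"
  shows "card (sorted_listings V f) = card (level_perms V f)"
proof -
  obtain u where u: "distinct u" "set u = V"
    using finite_distinct_list[OF assms] by blast
  define w where "w = sort_key f u"
  have w: "w \<in> sorted_listings V f" "set w = V"
    using u by (simp_all add: w_def sorted_listings_iff)
  have "inj_on (\<lambda>\<sigma>. map \<sigma> w) (level_perms V f)"
  proof (rule inj_onI)
    fix \<sigma> \<tau> assume "\<sigma> \<in> level_perms V f" "\<tau> \<in> level_perms V f" "map \<sigma> w = map \<tau> w"
    then have "\<sigma> x = \<tau> x" for x
      using w(2) by (cases "x \<in> V") (auto simp: level_perms_def permutes_def)
    then show "\<sigma> = \<tau>" ..
  qed
  then show ?thesis
    unfolding sorted_listings_eq_image_level_perms[OF w(1)] by (rule card_image)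
qed

lemma permutes_comp_transpose_iff:
  assumes "u \<in> V" "v \<in> V" "\<sigma> u = v"
  shows "\<sigma> \<circ> transpose u v permutes V - {v} \<longleftrightarrow> \<sigma> permutes V" (is "?\<tau> permutes _ \<longleftrightarrow> _")
proof
  assume "\<sigma> permutes V"
  then have "?\<tau> permutes V" using assms by (simp add: permutes_compose permutes_swap_id)
  then show "?\<tau> permutes V - {v}" by (rule permutes_superset) (use assms in auto)
next
  assume "?\<tau> permutes V - {v}"
  then have "?\<tau> permutes V" by (rule permutes_subset) auto
  then have "?\<tau> \<circ> transpose u v permutes V"
    using assms by (simp only: permutes_compose permutes_swap_id)
  then show "\<sigma> permutes V" by (simp add: comp_assoc)
qed

context
  fixes F :: "('a \<times> 'a) set" and V :: "'a set" and f :: "'a \<Rightarrow> 'b::linorder" and u v :: 'a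
  assumes F: "(u, v) \<in> F" "v \<notin> Domain F" "single_valued F"
    and V: "u \<in> V" "v \<in> V" and level: "f v = f u"
begin

lemma subset_list_arcs_remove_sink:
  "F \<subseteq> list_arcs (xs @ u # v # ys) \<longleftrightarrow> F - {(u, v)} \<subseteq> list_arcs (xs @ u # ys)"
proof -
  have "(u, y) \<in> F \<Longrightarrow> y = v" for y using F by (meson single_valuedD)
  then have no_arc: "(u, y) \<notin> F - {(u, v)}" "(v, y) \<notin> F" for y
    using F(2) by auto
  have "list_arcs (xs @ u # v # ys) = insert (u, v) (list_arcs (xs @ [u]) \<union> list_arcs (v # ys))"
    by (subst list_arcs_append_Cons) simp
  moreover have "list_arcs (xs @ u # ys) = list_arcs (xs @ [u]) \<union> list_arcs (u # ys)"
    by (rule list_arcs_append_Cons)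
  moreover have "F - {(u, v)} \<subseteq> P \<union> list_arcs (v # ys) \<longleftrightarrow> F - {(u, v)} \<subseteq> P \<union> list_arcs (u # ys)"
    for P
    using no_arc by (cases ys) auto
  ultimately show ?thesis by (simp add: subset_insert_iff F(1))
qed

lemma listings_through_remove_sink_iff:
  "xs @ u # v # ys \<in> listings_through V f F \<longleftrightarrow>
    xs @ u # ys \<in> listings_through (V - {v}) f (F - {(u, v)})"
proof -
  have "distinct (xs @ u # v # ys) \<and> set (xs @ u # v # ys) = V \<longleftrightarrow>
      distinct (xs @ u # ys) \<and> set (xs @ u # ys) = V - {v}"
    using V(2) by auto
  moreover have "sorted (map f (xs @ u # v # ys)) \<longleftrightarrow> sorted (map f (xs @ u # ys))"
    using level by (auto simp: sorted_append)
  ultimately show ?thesis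
    unfolding listings_through_def mem_Collect_eq sorted_listings_iff subset_list_arcs_remove_sink
    by blast
qed

lemma card_listings_through_remove_sink:
  "card (listings_through V f F) = card (listings_through (V - {v}) f (F - {(u, v)}))"
proof (rule bij_betw_same_card)
  have split: "\<exists>xs ys. w = xs @ u # v # ys \<and> remove1 v w = xs @ u # ys \<and> u \<notin> set xs \<union> set ys"
    if "w \<in> listings_through V f F" for w
  proof -
    have w: "distinct w" "(u, v) \<in> list_arcs w"
      using that F(1) by (auto simp: listings_through_def sorted_listings_iff)
    from w(2) obtain xs ys where "w = xs @ u # v # ys" by (rule list_arcs_split)
    with w(1) show ?thesis by (auto simp: remove1_append)
  qed
  show "bij_betw (remove1 v) (listings_through V f F) (listings_through (V - {v}) f (F - {(u, v)}))"
    unfolding bij_betw_def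
  proof (intro conjI inj_onI subset_antisym subsetI)
    fix w w' assume "w \<in> listings_through V f F" "w' \<in> listings_through V f F"
      and eq: "remove1 v w = remove1 v w'"
    then obtain xs ys xs' ys' where
      "w = xs @ u # v # ys" "remove1 v w = xs @ u # ys" "u \<notin> set xs \<union> set ys"
      "w' = xs' @ u # v # ys'" "remove1 v w' = xs' @ u # ys'"
      using split by metis
    with eq show "w = w'" by (simp add: append_Cons_eq_iff)
  next
    fix w' assume "w' \<in> remove1 v ` listings_through V f F"
    then show "w' \<in> listings_through (V - {v}) f (F - {(u, v)})"
      using split listings_through_remove_sink_iff by fastforce
  next
    fix w' assume w': "w' \<in> listings_through (V - {v}) f (F - {(u, v)})"
    then have "u \<in> set w'"
      using V(1) F(1,2) by (auto simp: listings_through_def sorted_listings_iff)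
    then obtain xs ys where xs_ys: "w' = xs @ u # ys" by (meson split_list)
    then have mem: "xs @ u # v # ys \<in> listings_through V f F"
      using w' listings_through_remove_sink_iff by simp
    moreover have "remove1 v (xs @ u # v # ys) = w'"
      using mem by (auto simp: xs_ys remove1_append listings_through_def sorted_listings_iff)
    ultimately show "w' \<in> remove1 v ` listings_through V f F" by (metis imageI)
  qed
qed

text \<open>Composing with \<open>transpose u v\<close> cuts \<open>v\<close> out of the cycle in which it follows \<open>u\<close>.\<close>

lemma perms_through_remove_sink_iff:
  "\<sigma> \<in> perms_through V f F \<longleftrightarrow>
    \<sigma> \<circ> transpose u v \<in> perms_through (V - {v}) f (F - {(u, v)})" (is "_ \<longleftrightarrow> ?\<tau> \<in> _")
proof (cases "\<sigma> u = v")
  case True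
  have ne: "u \<noteq> v" using F(1,2) by auto
  have u_arc: "(u, y) \<in> F \<longleftrightarrow> y = v" for y using F(1,3) by (auto dest: single_valuedD)
  have "?\<tau> permutes V - {v} \<longleftrightarrow> \<sigma> permutes V"
    using True V by (simp add: permutes_comp_transpose_iff)
  moreover have "(\<forall>x\<in>V. f (\<sigma> x) = f x) \<longleftrightarrow> (\<forall>x\<in>V - {v}. f (?\<tau> x) = f x)"
  proof -
    have "(\<forall>x\<in>V. P x) \<longleftrightarrow> P u \<and> P v \<and> (\<forall>x\<in>V - {u, v}. P x)"
      "(\<forall>x\<in>V - {v}. P x) \<longleftrightarrow> P u \<and> (\<forall>x\<in>V - {u, v}. P x)" for P
      using V ne by auto
    then show ?thesis using True level by simp
  qed
  moreover have "F \<subseteq> perm_arcs \<sigma> V \<longleftrightarrow> F - {(u, v)} \<subseteq> perm_arcs ?\<tau> (V - {v})"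
  proof -
    have "arc \<in> perm_arcs \<sigma> V \<longleftrightarrow> arc \<in> perm_arcs ?\<tau> (V - {v})" if "arc \<in> F - {(u, v)}" for arc
    proof (cases arc)
      case (Pair x y)
      with that u_arc F(2) have "x \<noteq> u" "x \<noteq> v" by auto
      then show ?thesis by (simp add: Pair)
    qed
    moreover have "(u, v) \<in> perm_arcs \<sigma> V" using True V by simp
    ultimately show ?thesis by blast
  qed
  ultimately show ?thesis unfolding perms_through_def level_perms_def by blast
next
  case False
  then have "\<sigma> \<notin> perms_through V f F" using F(1) by (auto simp: perms_through_def)
  moreover have "\<not> ?\<tau> permutes V - {v}" using False permutes_not_in[of ?\<tau> "V - {v}" v] by auto
  ultimately show ?thesis by (simp add: perms_through_def level_perms_def)
qed

lemma card_perms_through_remove_sink: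
  "card (perms_through V f F) = card (perms_through (V - {v}) f (F - {(u, v)}))"
proof (rule bij_betw_same_card)
  have involution: "\<sigma> \<circ> transpose u v \<circ> transpose u v = \<sigma>" for \<sigma> :: "'a \<Rightarrow> 'a"
    by (simp add: comp_assoc)
  show "bij_betw (\<lambda>\<sigma>. \<sigma> \<circ> transpose u v) (perms_through V f F)
      (perms_through (V - {v}) f (F - {(u, v)}))"
    by (rule bij_betw_byWitness[where f' = "\<lambda>\<sigma>. \<sigma> \<circ> transpose u v"])
      (auto simp: involution perms_through_remove_sink_iff)
qed

end

lemma finite_acyclic_obtains_sink:
  assumes "finite F" "acyclic F" "F \<noteq> {}"
  obtains u v where "(u, v) \<in> F" "v \<notin> Domain F"
proof -
  have "wf (F\<inverse>)" using assms by (simp add: finite_acyclic_wf_converse)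
  moreover obtain z where "z \<in> Range F" using assms(3) by auto
  ultimately obtain v where "v \<in> Range F" "\<And>y. (y, v) \<in> F\<inverse> \<Longrightarrow> y \<notin> Range F"
    by (rule wfE_min) blast
  then show ?thesis using that by blast
qed

lemma card_listings_through_eq_if_single_valued:
  assumes "finite F" "finite V" "F \<subseteq> V \<times> V" "acyclic F" "single_valued F" "single_valued (F\<inverse>)"
    and "\<And>u v. (u, v) \<in> F \<Longrightarrow> f v = f u"
  shows "card (listings_through V f F) = card (perms_through V f F)"
  using assms
proof (induction arbitrary: V rule: finite_psubset_induct)
  case (psubset F)
  show ?case
  proof (cases "F = {}")
    case True
    then show ?thesis
      using psubset.prems by (simp add: listings_through_def perms_through_def card_sorted_listings)
  next
    case False
    then obtain u v where sink: "(u, v) \<in> F" "v \<notin> Domain F"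
      using psubset.hyps psubset.prems by (metis finite_acyclic_obtains_sink)
    have V: "u \<in> V" "v \<in> V" and level: "f v = f u" using sink psubset.prems by auto
    have "card (listings_through (V - {v}) f (F - {(u, v)})) =
        card (perms_through (V - {v}) f (F - {(u, v)}))"
    proof (rule psubset.IH)
      have "x \<noteq> v \<and> y \<noteq> v" if "(x, y) \<in> F - {(u, v)}" for x y
        using that sink psubset.prems(5) by (auto dest: single_valuedD)
      then show "F - {(u, v)} \<subseteq> (V - {v}) \<times> (V - {v})" using psubset.prems(2) by fast
    next
      have sub: "F - {(u, v)} \<subseteq> F" "(F - {(u, v)})\<inverse> \<subseteq> F\<inverse>" by auto
      show "acyclic (F - {(u, v)})" using psubset.prems(3) sub(1) by (rule acyclic_subset)
      show "single_valued (F - {(u, v)})"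
        using sub(1) psubset.prems(4) by (rule single_valued_subset)
      show "single_valued ((F - {(u, v)})\<inverse>)"
        using sub(2) psubset.prems(5) by (rule single_valued_subset)
    qed (use psubset.prems sink in auto)
    then show ?thesis
      using card_listings_through_remove_sink[of u v F V f]
        card_perms_through_remove_sink[of u v F V f]
        sink V level psubset.prems(4) by presburger
  qed
qed

theorem card_listings_through_eq_card_perms_through:
  assumes "finite V" "F \<subseteq> V \<times> V" "acyclic F" "\<And>u v. (u, v) \<in> F \<Longrightarrow> f v = f u"
  shows "card (listings_through V f F) = card (perms_through V f F)"
proof (cases "single_valued F \<and> single_valued (F\<inverse>)")
  case True
  moreover have "finite F" using assms by (meson finite_SigmaI finite_subset)
  ultimately show ?thesis
    using assms by (intro card_listings_through_eq_if_single_valued) auto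
next
  case False
  have "\<not> F \<subseteq> list_arcs w" if "w \<in> sorted_listings V f" for w
    using that False single_valued_list_arcs[of w] single_valued_converse_list_arcs[of w]
    by (meson converse_mono single_valued_subset sorted_listings_iff)
  moreover have "\<not> F \<subseteq> perm_arcs \<sigma> V" if "\<sigma> \<in> level_perms V f" for \<sigma>
  proof -
    have "inj_on \<sigma> V" using that by (auto simp: level_perms_def permutes_inj_on)
    then show ?thesis
      using False single_valued_perm_arcs[of \<sigma> V] single_valued_converse_perm_arcs[of \<sigma> V]
      by (meson converse_mono single_valued_subset)
  qed
  ultimately have "listings_through V f F = {}" "perms_through V f F = {}"
    by (auto simp: listings_through_def perms_through_def)
  then show ?thesis by simp
qed

section \<open>Inclusion-exclusion\<close>

lemma alternating_sum_Pow:
  assumes "finite X"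
  shows "(\<Sum>S\<in>Pow X. (-1) ^ card S :: int) = (if X = {} then 1 else 0)"
proof -
  have "(\<Sum>S\<in>Pow X. (-1) ^ card S :: int) = 0 ^ card X"
    using prod_diff_conv_sum[OF assms, of "\<lambda>_. 1" "\<lambda>_. 1 :: int"] by simp
  then show ?thesis using assms by (simp add: power_0_left)
qed

lemma card_avoiding_eq_alternating_sum:
  assumes "finite X" "finite B"
  shows "int (card {x \<in> X. E x \<inter> B = {}}) =
    (\<Sum>F\<in>Pow B. (-1) ^ card F * int (card {x \<in> X. F \<subseteq> E x}))"
proof -
  have "int (card {x \<in> X. E x \<inter> B = {}}) = (\<Sum>x\<in>X. if E x \<inter> B = {} then 1 else 0)"
    using assms(1) by (simp flip: sum.inter_filter)
  also have "\<dots> = (\<Sum>x\<in>X. \<Sum>F\<in>Pow B. if F \<subseteq> E x then (-1) ^ card F else 0)"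
  proof (intro sum.cong refl)
    fix x
    have "(\<Sum>F\<in>Pow B. if F \<subseteq> E x then (-1) ^ card F else 0 :: int) =
        (\<Sum>F\<in>Pow (E x \<inter> B). (-1) ^ card F)"
      using assms(2) by (subst sum.inter_filter[symmetric]) (auto intro!: sum.cong)
    also have "\<dots> = (if E x \<inter> B = {} then 1 else 0)"
      using assms(2) by (intro alternating_sum_Pow) simp
    finally show "(if E x \<inter> B = {} then 1 else 0) =
        (\<Sum>F\<in>Pow B. if F \<subseteq> E x then (-1) ^ card F else 0 :: int)" by simp
  qed
  also have "\<dots> = (\<Sum>F\<in>Pow B. \<Sum>x\<in>X. if F \<subseteq> E x then (-1) ^ card F else 0)"
    by (rule sum.swap)
  also have "\<dots> = (\<Sum>F\<in>Pow B. (-1) ^ card F * int (card {x \<in> X. F \<subseteq> E x}))"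
    using assms(1) by (simp add: mult.commute flip: sum.inter_filter)
  finally show ?thesis .
qed

lemma sum_power_card_partition:
  fixes c :: "'c::comm_semiring_1"
  assumes "finite V" "partition_on V \<Q>"
  shows "(\<Sum>S | S \<subseteq> V \<and> (\<forall>Q\<in>\<Q>. P Q (S \<inter> Q)). c ^ card S) =
    (\<Prod>Q\<in>\<Q>. \<Sum>S | S \<subseteq> Q \<and> P Q S. c ^ card S)"
proof -
  have V: "V = \<Union>\<Q>" and disj: "disjoint \<Q>"
    using assms(2) by (auto simp: partition_on_def)
  have fin: "finite \<Q>" "\<And>Q. Q \<in> \<Q> \<Longrightarrow> finite Q"
    using assms(1) finite_elements[OF assms] unfolding V by (auto intro: finite_subset)
  have glue: "\<Union>(g ` \<Q>) \<inter> Q = g Q" if "Q \<in> \<Q>" "\<And>R. R \<in> \<Q> \<Longrightarrow> g R \<subseteq> R" for g Q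
    using that disj by (fastforce simp: disjoint_def)
  have "(\<Prod>Q\<in>\<Q>. \<Sum>S | S \<subseteq> Q \<and> P Q S. c ^ card S) =
      (\<Sum>g\<in>(\<Pi>\<^sub>E Q\<in>\<Q>. {S. S \<subseteq> Q \<and> P Q S}). \<Prod>Q\<in>\<Q>. c ^ card (g Q))"
    using fin by (intro prod_sum_PiE) auto
  also have "\<dots> = (\<Sum>S | S \<subseteq> V \<and> (\<forall>Q\<in>\<Q>. P Q (S \<inter> Q)). c ^ card S)"
  proof (rule sum.reindex_bij_witness
      [where i = "\<lambda>S. \<lambda>Q\<in>\<Q>. S \<inter> Q" and j = "\<lambda>g. \<Union>(g ` \<Q>)"])
    fix g assume g: "g \<in> (\<Pi>\<^sub>E Q\<in>\<Q>. {S. S \<subseteq> Q \<and> P Q S})"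
    then have sub: "g Q \<subseteq> Q" if "Q \<in> \<Q>" for Q using that by auto
    have blocks: "\<Union>(g ` \<Q>) \<inter> Q = g Q" if "Q \<in> \<Q>" for Q
      using that sub by (rule glue)
    show "(\<lambda>Q\<in>\<Q>. \<Union>(g ` \<Q>) \<inter> Q) = g"
      using g blocks by (intro extensionalityI[of _ \<Q>]) (auto simp: PiE_iff)
    show "\<Union>(g ` \<Q>) \<in> {S. S \<subseteq> V \<and> (\<forall>Q\<in>\<Q>. P Q (S \<inter> Q))}"
      using g sub unfolding V by (auto simp: blocks)
    have "card (\<Union>(g ` \<Q>)) = (\<Sum>Q\<in>\<Q>. card (g Q))"
    proof (rule card_UN_disjoint)
      show "\<forall>Q\<in>\<Q>. finite (g Q)" using fin sub by (meson finite_subset)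
      have "g Q \<inter> g R = {}" if "Q \<in> \<Q>" "R \<in> \<Q>" "Q \<noteq> R" for Q R
        using disjointD[OF disj that] sub[OF that(1)] sub[OF that(2)] by blast
      then show "\<forall>Q\<in>\<Q>. \<forall>R\<in>\<Q>. Q \<noteq> R \<longrightarrow> g Q \<inter> g R = {}" by blast
    qed (rule fin)
    then show "c ^ card (\<Union>(g ` \<Q>)) = (\<Prod>Q\<in>\<Q>. c ^ card (g Q))"
      by (simp add: power_sum)
  qed (auto simp: V)
  finally show ?thesis by simp
qed

section \<open>Orbits and the weight of a permutation\<close>

lemma orbit_eq_if_mem: "permutation \<sigma> \<Longrightarrow> y \<in> orbit \<sigma> x \<Longrightarrow> orbit \<sigma> y = orbit \<sigma> x"
  by (rule orbit_cyclic_eq3[OF cyclic_on_orbit'])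

lemma finite_orbit_permutation: "permutation \<sigma> \<Longrightarrow> finite (orbit \<sigma> x)"
  by (simp add: finite_orbit permutation_self_in_orbit)

lemma partition_on_orbits:
  assumes "finite V" "\<sigma> permutes V"
  shows "partition_on V (orbit \<sigma> ` V)"
proof (rule partition_onI)
  have perm: "permutation \<sigma>" using assms by (rule permutes_imp_permutation)
  show "\<Union>(orbit \<sigma> ` V) = V"
    using permutes_orbit_subset[OF assms(2)] permutation_self_in_orbit[OF perm] by fast
  show "disjnt Q R" if "Q \<in> orbit \<sigma> ` V" "R \<in> orbit \<sigma> ` V" "Q \<noteq> R" for Q R
    using that orbit_eq_if_mem[OF perm] unfolding disjnt_def by blast
  show "{} \<notin> orbit \<sigma> ` V" using orbit_nonempty by (metis imageE)
qed

lemma acyclic_perm_arcs_iff: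
  assumes "permutation \<sigma>"
  shows "acyclic (perm_arcs \<sigma> S) \<longleftrightarrow> (\<forall>x. \<not> orbit \<sigma> x \<subseteq> S)"
proof -
  let ?F = "perm_arcs \<sigma> S"
  have "(x, x) \<in> ?F\<^sup>+" if sub: "orbit \<sigma> x \<subseteq> S" for x
  proof -
    have self: "x \<in> orbit \<sigma> x" using assms by (rule permutation_self_in_orbit)
    have "(x, y) \<in> ?F\<^sup>+" if "y \<in> orbit \<sigma> x" for y
      using that
    proof induction
      case base
      show ?case using self sub by (intro r_into_trancl) auto
    next
      case (step y)
      then have "(y, \<sigma> y) \<in> ?F" using sub by auto
      with step.IH show ?case by (rule trancl_into_trancl)
    qed
    then show ?thesis using self .
  qed
  moreover have "orbit \<sigma> x \<subseteq> S" if cyc: "(x, x) \<in> ?F\<^sup>+" for x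
  proof -
    have continue: "y \<in> S \<and> (\<sigma> y, x) \<in> ?F\<^sup>+" if yx: "(y, x) \<in> ?F\<^sup>+" for y
    proof -
      obtain z where "(y, z) \<in> ?F" "(z, x) \<in> ?F\<^sup>*" using tranclD[OF yx] by blast
      moreover from this(2) have "(z, x) \<in> ?F\<^sup>+" using cyc by (meson rtrancl_trancl_trancl)
      ultimately show ?thesis by simp
    qed
    have "(y, x) \<in> ?F\<^sup>+" if "y \<in> orbit \<sigma> x" for y
      using that by induction (use cyc continue in blast)+
    then show ?thesis using continue by blast
  qed
  ultimately show ?thesis by (auto simp: acyclic_def)
qed

lemma acyclic_perm_arcs_iff_no_orbit:
  assumes "finite V" "\<sigma> permutes V" "S \<subseteq> V"
  shows "acyclic (perm_arcs \<sigma> S) \<longleftrightarrow> (\<forall>Q\<in>orbit \<sigma> ` V. \<not> Q \<subseteq> S)"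
proof -
  have perm: "permutation \<sigma>" using assms(1,2) by (rule permutes_imp_permutation)
  have "x \<in> V" if "orbit \<sigma> x \<subseteq> S" for x
    using that assms(3) permutation_self_in_orbit[OF perm, of x] by blast
  then show ?thesis unfolding acyclic_perm_arcs_iff[OF perm] by auto
qed

definition orbit_weight :: "('a \<times> 'a) set \<Rightarrow> ('a \<Rightarrow> 'a) \<Rightarrow> 'a set \<Rightarrow> int" where
  "orbit_weight A \<sigma> Q =
    (if perm_arcs \<sigma> Q \<subseteq> A then - ((-1) ^ card Q) else if perm_arcs \<sigma> Q \<inter> A = {} then 1 else 0)"

definition perm_weight :: "('a \<times> 'a) set \<Rightarrow> 'a set \<Rightarrow> ('a \<Rightarrow> 'a) \<Rightarrow> int" where
  "perm_weight A V \<sigma> = (\<Prod>Q\<in>orbit \<sigma> ` V. orbit_weight A \<sigma> Q)"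

lemma orbit_weight_eq_alternating_sum:
  assumes "finite Q" "Q \<noteq> {}"
  shows "orbit_weight A \<sigma> Q = (\<Sum>S | S \<subseteq> Q \<and> perm_arcs \<sigma> S \<subseteq> A \<and> \<not> Q \<subseteq> S. (-1) ^ card S)"
proof (cases "perm_arcs \<sigma> Q \<subseteq> A")
  case True
  then have "{S. S \<subseteq> Q \<and> perm_arcs \<sigma> S \<subseteq> A \<and> \<not> Q \<subseteq> S} = Pow Q - {Q}"
    by (auto simp: perm_arcs_def)
  then show ?thesis
    using True assms by (simp add: orbit_weight_def sum_diff1 alternating_sum_Pow)
next
  case False
  then have "{S. S \<subseteq> Q \<and> perm_arcs \<sigma> S \<subseteq> A \<and> \<not> Q \<subseteq> S} = Pow {x \<in> Q. (x, \<sigma> x) \<in> A}"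
    by (auto simp: perm_arcs_def)
  moreover have "perm_arcs \<sigma> Q \<inter> A = {} \<longleftrightarrow> {x \<in> Q. (x, \<sigma> x) \<in> A} = {}"
    by (auto simp: perm_arcs_def)
  ultimately show ?thesis
    using False assms(1) by (simp add: orbit_weight_def alternating_sum_Pow)
qed

lemma perm_weight_eq_alternating_sum:
  assumes "finite V" "\<sigma> permutes V"
  shows "perm_weight A V \<sigma> =
    (\<Sum>F | F \<subseteq> perm_arcs \<sigma> V \<inter> A \<and> acyclic F. (-1) ^ card F)"
proof -
  let ?\<Q> = "orbit \<sigma> ` V"
  note perm = permutes_imp_permutation[OF assms] and part = partition_on_orbits[OF assms]
  have "perm_weight A V \<sigma> =
      (\<Prod>Q\<in>?\<Q>. \<Sum>S | S \<subseteq> Q \<and> perm_arcs \<sigma> S \<subseteq> A \<and> \<not> Q \<subseteq> S. (-1) ^ card S)"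
    unfolding perm_weight_def
    by (intro prod.cong refl orbit_weight_eq_alternating_sum)
      (auto simp: finite_orbit_permutation[OF perm] orbit_nonempty)
  also have "\<dots> = (\<Sum>S | S \<subseteq> V \<and> (\<forall>Q\<in>?\<Q>. perm_arcs \<sigma> (S \<inter> Q) \<subseteq> A \<and> \<not> Q \<subseteq> S \<inter> Q). (-1) ^ card S)"
    by (rule sum_power_card_partition[OF assms(1) part, symmetric])
  also have "\<dots> = (\<Sum>S | S \<subseteq> V \<and> perm_arcs \<sigma> S \<subseteq> A \<and> acyclic (perm_arcs \<sigma> S). (-1) ^ card S)"
  proof (intro sum.cong refl Collect_cong conj_cong)
    fix S assume "S \<subseteq> V"
    then have "S = (\<Union>Q\<in>?\<Q>. S \<inter> Q)" using partition_onD1[OF part] by blast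
    then have "perm_arcs \<sigma> S = (\<Union>Q\<in>?\<Q>. perm_arcs \<sigma> (S \<inter> Q))"
      unfolding perm_arcs_def by blast
    then have "perm_arcs \<sigma> S \<subseteq> A \<longleftrightarrow> (\<forall>Q\<in>?\<Q>. perm_arcs \<sigma> (S \<inter> Q) \<subseteq> A)" by blast
    moreover have "acyclic (perm_arcs \<sigma> S) \<longleftrightarrow> (\<forall>Q\<in>?\<Q>. \<not> Q \<subseteq> S \<inter> Q)"
      using acyclic_perm_arcs_iff_no_orbit[OF assms \<open>S \<subseteq> V\<close>] by simp
    ultimately show "(\<forall>Q\<in>?\<Q>. perm_arcs \<sigma> (S \<inter> Q) \<subseteq> A \<and> \<not> Q \<subseteq> S \<inter> Q) \<longleftrightarrow>
        perm_arcs \<sigma> S \<subseteq> A \<and> acyclic (perm_arcs \<sigma> S)" by (simp only: ball_conj_distrib)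
  qed
  also have "\<dots> = (\<Sum>F | F \<subseteq> perm_arcs \<sigma> V \<inter> A \<and> acyclic F. (-1) ^ card F)"
  proof (rule sum.reindex_cong[symmetric])
    show "inj_on (perm_arcs \<sigma>) {S. S \<subseteq> V \<and> perm_arcs \<sigma> S \<subseteq> A \<and> acyclic (perm_arcs \<sigma> S)}"
      by (rule inj_onI) (auto simp: set_eq_iff)
    show "{F. F \<subseteq> perm_arcs \<sigma> V \<inter> A \<and> acyclic F} =
        perm_arcs \<sigma> ` {S. S \<subseteq> V \<and> perm_arcs \<sigma> S \<subseteq> A \<and> acyclic (perm_arcs \<sigma> S)}"
      by (auto simp: perm_arcs_def subset_image_iff)
    show "(-1) ^ card (perm_arcs \<sigma> S) = ((-1) ^ card S :: int)" for S
      by (simp add: perm_arcs_def card_image inj_on_def)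
  qed
  finally show ?thesis .
qed

definition compatible :: "('a \<times> 'a) set \<Rightarrow> 'a list \<Rightarrow> ('a \<Rightarrow> 'b::linorder) \<Rightarrow> bool" where
  "compatible A w f \<longleftrightarrow>
    sorted (map f w) \<and> (\<forall>(u, v)\<in>list_arcs w. (u, v) \<in> A \<longrightarrow> f u \<noteq> f v)"

definition level_arcs :: "('a \<times> 'a) set \<Rightarrow> 'a set \<Rightarrow> ('a \<Rightarrow> 'b) \<Rightarrow> ('a \<times> 'a) set" where
  "level_arcs A V f = {(u, v) \<in> A. u \<in> V \<and> v \<in> V \<and> f u = f v}"

lemma finite_level_arcs: "finite V \<Longrightarrow> finite (level_arcs A V f)"
  by (rule finite_subset[of _ "V \<times> V"]) (auto simp: level_arcs_def)

lemma card_compatible_listings_eq_alternating_sum: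
  assumes "finite V"
  shows "int (card {w \<in> permutations_of_set V. compatible A w f}) =
    (\<Sum>F | F \<subseteq> level_arcs A V f \<and> acyclic F. (-1) ^ card F * int (card (perms_through V f F)))"
proof -
  let ?B = "level_arcs A V f"
  have "{w \<in> permutations_of_set V. compatible A w f} =
      {w \<in> sorted_listings V f. list_arcs w \<inter> ?B = {}}"
    using list_arcs_subset
    by (fastforce simp: level_arcs_def compatible_def sorted_listings_def permutations_of_set_def)
  then have "int (card {w \<in> permutations_of_set V. compatible A w f}) =
      (\<Sum>F\<in>Pow ?B. (-1) ^ card F * int (card (listings_through V f F)))"
    by (simp add: card_avoiding_eq_alternating_sum finite_level_arcs[OF assms] listings_through_def)
  also have "\<dots> =
      (\<Sum>F | F \<subseteq> ?B \<and> acyclic F. (-1) ^ card F * int (card (perms_through V f F)))"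
  proof (intro sum.mono_neutral_cong_right)
    have "listings_through V f F = {}" if "\<not> acyclic F" for F
      using that by (auto simp: listings_through_def sorted_listings_iff
          dest: acyclic_list_arcs acyclic_subset)
    then show "\<forall>F\<in>Pow ?B - {F. F \<subseteq> ?B \<and> acyclic F}.
        (-1) ^ card F * int (card (listings_through V f F)) = 0"
      by auto
    fix F assume "F \<in> {F. F \<subseteq> ?B \<and> acyclic F}"
    then have "card (listings_through V f F) = card (perms_through V f F)"
      using assms
      by (intro card_listings_through_eq_card_perms_through) (auto simp: level_arcs_def)
    then show "(-1) ^ card F * int (card (listings_through V f F)) =
        (-1) ^ card F * int (card (perms_through V f F))" by simp
  qed (use finite_level_arcs[OF assms] in auto)
  finally show ?thesis .
qed

lemma sum_perm_weight_level_perms: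
  assumes "finite V"
  shows "(\<Sum>\<sigma>\<in>level_perms V f. perm_weight A V \<sigma>) =
    (\<Sum>F | F \<subseteq> level_arcs A V f \<and> acyclic F. (-1) ^ card F * int (card (perms_through V f F)))"
proof -
  let ?\<F> = "{F. F \<subseteq> level_arcs A V f \<and> acyclic F}"
  have fin: "finite ?\<F>" using finite_level_arcs[OF assms, of A f] by simp
  have "(\<Sum>\<sigma>\<in>level_perms V f. perm_weight A V \<sigma>) =
      (\<Sum>\<sigma>\<in>level_perms V f. \<Sum>F\<in>?\<F>. if F \<subseteq> perm_arcs \<sigma> V then (-1) ^ card F else 0)"
  proof (intro sum.cong refl)
    fix \<sigma> assume "\<sigma> \<in> level_perms V f"
    then have \<sigma>: "\<sigma> permutes V" and "perm_arcs \<sigma> V \<inter> A \<subseteq> level_arcs A V f"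
      by (auto simp: level_perms_def level_arcs_def permutes_in_image)
    then have "{F \<in> ?\<F>. F \<subseteq> perm_arcs \<sigma> V} = {F. F \<subseteq> perm_arcs \<sigma> V \<inter> A \<and> acyclic F}"
      by (auto simp: level_arcs_def)
    then show "perm_weight A V \<sigma> =
        (\<Sum>F\<in>?\<F>. if F \<subseteq> perm_arcs \<sigma> V then (-1) ^ card F else 0)"
      unfolding perm_weight_eq_alternating_sum[OF assms \<sigma>] sum.inter_filter[OF fin, symmetric]
      by simp
  qed
  also have "\<dots> =
      (\<Sum>F\<in>?\<F>. \<Sum>\<sigma>\<in>level_perms V f. if F \<subseteq> perm_arcs \<sigma> V then (-1) ^ card F else 0)"
    by (rule sum.swap)
  also have "\<dots> = (\<Sum>F\<in>?\<F>. (-1) ^ card F * int (card (perms_through V f F)))"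
    using assms by (simp add: perms_through_def mult.commute flip: sum.inter_filter)
  finally show ?thesis .
qed

section \<open>Power sums and labellings\<close>

definition content :: "'a set \<Rightarrow> ('a \<Rightarrow> 'b) \<Rightarrow> 'b multiset" where
  "content V f = image_mset f (mset_set V)"

lemma finite_fibres_content:
  assumes "finite V"
  shows "finite_fibres (V \<rightarrow>\<^sub>E X) (content V)"
  unfolding finite_fibres_def
proof
  fix m
  have "{f \<in> V \<rightarrow>\<^sub>E X. content V f = m} \<subseteq> V \<rightarrow>\<^sub>E set_mset m"
    using assms by (auto simp: content_def PiE_iff extensional_def)
  then show "finite {f \<in> V \<rightarrow>\<^sub>E X. content V f = m}"
    by (rule finite_subset) (simp add: assms finite_PiE)
qed

lemma content_eq_sum_fibres:
  fixes V :: "'a set" and h :: "'a \<Rightarrow> 'b" and g :: "'b \<Rightarrow> 'c"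
  assumes "finite V"
  shows "content V (\<lambda>x. g (h x)) = (\<Sum>q\<in>h ` V. replicate_mset (card {x \<in> V. h x = q}) (g q))"
proof -
  have const: "(\<Sum>x\<in>S. {#c#}) = replicate_mset (card S) c" for S :: "'a set" and c :: 'c
    by (induction S rule: infinite_finite_induct) simp_all
  have "content V (\<lambda>x. g (h x)) = (\<Sum>x\<in>V. {#g (h x)#})"
    by (simp add: content_def sum_unfold_sum_mset)
  also have "\<dots> = (\<Sum>q\<in>h ` V. \<Sum>x | x \<in> V \<and> h x = q. {#g (h x)#})"
    using assms by (rule sum.image_gen)
  also have "\<dots> = (\<Sum>q\<in>h ` V. replicate_mset (card {x \<in> V. h x = q}) (g q))"
    by (intro sum.cong refl) (simp add: const)
  finally show ?thesis .
qed

lemma bij_betw_functions_constant_on_fibres: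
  "bij_betw (\<lambda>g. \<lambda>x\<in>V. g (h x)) (h ` V \<rightarrow>\<^sub>E X)
    {f \<in> V \<rightarrow>\<^sub>E X. \<forall>x\<in>V. \<forall>y\<in>V. h x = h y \<longrightarrow> f x = f y}"
proof (rule bij_betw_byWitness[where f' = "\<lambda>f. \<lambda>q\<in>h ` V. f (inv_into V h q)"])
  show "\<forall>g\<in>h ` V \<rightarrow>\<^sub>E X. (\<lambda>q\<in>h ` V. (\<lambda>x\<in>V. g (h x)) (inv_into V h q)) = g"
    by (intro ballI extensionalityI[of _ "h ` V"]) (auto simp: inv_into_into f_inv_into_f PiE_iff)
  show "\<forall>f\<in>{f \<in> V \<rightarrow>\<^sub>E X. \<forall>x\<in>V. \<forall>y\<in>V. h x = h y \<longrightarrow> f x = f y}.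
      (\<lambda>x\<in>V. (\<lambda>q\<in>h ` V. f (inv_into V h q)) (h x)) = f"
  proof
    fix f assume f: "f \<in> {f \<in> V \<rightarrow>\<^sub>E X. \<forall>x\<in>V. \<forall>y\<in>V. h x = h y \<longrightarrow> f x = f y}"
    have "f (inv_into V h (h x)) = f x" if "x \<in> V" for x
    proof -
      have "inv_into V h (h x) \<in> V" "h (inv_into V h (h x)) = h x"
        using that by (simp_all add: inv_into_into f_inv_into_f)
      with f that show ?thesis by blast
    qed
    moreover have "f \<in> extensional V" using f by (simp add: PiE_iff)
    ultimately show "(\<lambda>x\<in>V. (\<lambda>q\<in>h ` V. f (inv_into V h q)) (h x)) = f"
      by (intro extensionalityI[of _ V]) simp_all
  qed
qed (auto simp: inv_into_into)

lemma powersum_eq_genseries: "powersum k = genseries {1..} (replicate_mset k)"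
  by (simp add: powersum_def genseries_def)

lemma finite_fibres_replicate_mset: "k > 0 \<Longrightarrow> finite_fibres S (replicate_mset k)"
  unfolding finite_fibres_def
proof
  fix m :: "'a multiset" assume "k > 0"
  then have "{i \<in> S. replicate_mset k i = m} \<subseteq> set_mset m" by auto
  then show "finite {i \<in> S. replicate_mset k i = m}" by (rule finite_subset) simp
qed

lemma prod_powersum_card_fibres:
  assumes "finite V"
  shows "(\<Prod>q\<in>h ` V. powersum (card {x \<in> V. h x = q})) =
    genseries {f \<in> V \<rightarrow>\<^sub>E {1..}. \<forall>x\<in>V. \<forall>y\<in>V. h x = h y \<longrightarrow> f x = f y} (content V)"
proof -
  have "card {x \<in> V. h x = q} > 0" if "q \<in> h ` V" for q
    using assms that by (auto simp: card_gt_0_iff)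
  then have "(\<Prod>q\<in>h ` V. powersum (card {x \<in> V. h x = q})) =
      genseries (h ` V \<rightarrow>\<^sub>E {1..}) (\<lambda>g. \<Sum>q\<in>h ` V. replicate_mset (card {x \<in> V. h x = q}) (g q))"
    unfolding powersum_eq_genseries
    using assms by (intro prod_genseries finite_fibres_replicate_mset) auto
  also have "\<dots> = genseries {f \<in> V \<rightarrow>\<^sub>E {1..}. \<forall>x\<in>V. \<forall>y\<in>V. h x = h y \<longrightarrow> f x = f y} (content V)"
  proof (rule genseries_reindex[OF bij_betw_functions_constant_on_fibres])
    fix g :: "'b \<Rightarrow> nat"
    have "content V (\<lambda>x\<in>V. g (h x)) = content V (\<lambda>x. g (h x))"
      unfolding content_def using assms by (intro image_mset_cong) auto
    then show "content V (\<lambda>x\<in>V. g (h x)) =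
        (\<Sum>q\<in>h ` V. replicate_mset (card {x \<in> V. h x = q}) (g q))"
      by (simp only: content_eq_sum_fibres[OF assms])
  qed
  finally show ?thesis .
qed

lemma orbit_fibre:
  assumes "finite V" "\<sigma> permutes V" "Q \<in> orbit \<sigma> ` V"
  shows "{x \<in> V. orbit \<sigma> x = Q} = Q"
proof -
  have perm: "permutation \<sigma>" using assms(1,2) by (rule permutes_imp_permutation)
  have "Q \<subseteq> V" using partition_onD1[OF partition_on_orbits[OF assms(1,2)]] assms(3) by auto
  then show ?thesis
    using assms(3) orbit_eq_if_mem[OF perm] permutation_self_in_orbit[OF perm] by blast
qed

lemma invariant_iff_constant_on_orbits:
  assumes "permutation \<sigma>" "\<sigma> permutes V"
  shows "(\<forall>x\<in>V. f (\<sigma> x) = f x) \<longleftrightarrow> (\<forall>x\<in>V. \<forall>y\<in>V. orbit \<sigma> x = orbit \<sigma> y \<longrightarrow> f x = f y)"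
proof
  assume inv: "\<forall>x\<in>V. f (\<sigma> x) = f x"
  have "f z = f y" if "z \<in> orbit \<sigma> y" "y \<in> V" for y z
    using that
  proof induction
    case (step z)
    then have "z \<in> V" using permutes_orbit_subset[OF assms(2)] by blast
    with step inv show ?case by simp
  qed (use inv in simp)
  then show "\<forall>x\<in>V. \<forall>y\<in>V. orbit \<sigma> x = orbit \<sigma> y \<longrightarrow> f x = f y"
    using permutation_self_in_orbit[OF assms(1)] by metis
next
  assume "\<forall>x\<in>V. \<forall>y\<in>V. orbit \<sigma> x = orbit \<sigma> y \<longrightarrow> f x = f y"
  then show "\<forall>x\<in>V. f (\<sigma> x) = f x"
    by (metis permutation_orbit_step[OF assms(1)] permutes_in_image[OF assms(2)])
qed

lemma prod_powersum_card_orbits: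
  assumes "finite V" "\<sigma> permutes V"
  shows "(\<Prod>Q\<in>orbit \<sigma> ` V. powersum (card Q)) =
    genseries {f \<in> V \<rightarrow>\<^sub>E {1..}. \<forall>x\<in>V. f (\<sigma> x) = f x} (content V)"
proof -
  have "(\<Prod>Q\<in>orbit \<sigma> ` V. powersum (card Q)) =
      (\<Prod>Q\<in>orbit \<sigma> ` V. powersum (card {x \<in> V. orbit \<sigma> x = Q}))"
    by (intro prod.cong refl) (simp only: orbit_fibre[OF assms])
  then show ?thesis
    unfolding prod_powersum_card_fibres[OF assms(1)]
      invariant_iff_constant_on_orbits[OF permutes_imp_permutation[OF assms] assms(2)] .
qed

section \<open>The signed power sum expansion\<close>

lemma compatible_iff_strict_at_Des:
  "compatible (parcs D) w f \<longleftrightarrow>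
    sorted (map f w) \<and> (\<forall>p\<in>Des w D. map f w ! (p - 1) < map f w ! p)"
proof -
  have Des: "(\<forall>p\<in>Des w D. map f w ! (p - 1) < map f w ! p) \<longleftrightarrow>
      (\<forall>i. Suc i < length w \<longrightarrow> (w ! i, w ! Suc i) \<in> parcs D \<longrightarrow> f (w ! i) < f (w ! Suc i))"
  proof -
    have "p \<in> Des w D \<longleftrightarrow> (\<exists>i. p = Suc i \<and> Suc i < length w \<and> (w ! i, w ! Suc i) \<in> parcs D)" for p
      by (cases p) (auto simp: Des_def)
    then have "Des w D = {Suc i |i. Suc i < length w \<and> (w ! i, w ! Suc i) \<in> parcs D}" by auto
    then show ?thesis by auto
  qed
  have "f (w ! i) < f (w ! Suc i) \<longleftrightarrow> f (w ! i) \<noteq> f (w ! Suc i)"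
    if "sorted (map f w)" "Suc i < length w" for i
    using sorted_nth_mono[OF that(1), of i "Suc i"] that(2) by auto
  moreover have "(\<forall>(u, v)\<in>list_arcs w. P u v) \<longleftrightarrow>
      (\<forall>i. Suc i < length w \<longrightarrow> P (w ! i) (w ! Suc i))" for P
  proof -
    have "list_arcs w = {(w ! i, w ! Suc i) |i. Suc i < length w}" by (auto simp: list_arcs_iff)
    then show ?thesis by fastforce
  qed
  ultimately show ?thesis unfolding compatible_def Des by auto
qed

lemma bij_betw_map_PiE:
  assumes "distinct w"
  shows "bij_betw (\<lambda>f. map f w) (set w \<rightarrow>\<^sub>E X) {is. length is = length w \<and> set is \<subseteq> X}"
proof (rule bij_betw_byWitness[where f' = "\<lambda>is. \<lambda>x\<in>set w. the (map_of (zip w is) x)"])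
  show "\<forall>f\<in>set w \<rightarrow>\<^sub>E X. (\<lambda>x\<in>set w. the (map_of (zip w (map f w)) x)) = f"
    by (intro ballI extensionalityI[of _ "set w"]) (auto simp: map_of_zip_map PiE_iff)
  have inverse: "map (\<lambda>x\<in>set w. the (map_of (zip w is) x)) w = is"
    if "length is = length w" for "is"
    using assms that by (intro nth_equalityI) (auto simp: map_of_zip_nth)
  then show "\<forall>is\<in>{is. length is = length w \<and> set is \<subseteq> X}.
      map (\<lambda>x\<in>set w. the (map_of (zip w is) x)) w = is" by blast
  show "(\<lambda>is. \<lambda>x\<in>set w. the (map_of (zip w is) x)) ` {is. length is = length w \<and> set is \<subseteq> X}
      \<subseteq> set w \<rightarrow>\<^sub>E X"
  proof (rule image_subsetI)
    fix "is" assume "is \<in> {is. length is = length w \<and> set is \<subseteq> X}"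
    then have len: "length is = length w" and sub: "set is \<subseteq> X" by simp_all
    let ?f = "\<lambda>x\<in>set w. the (map_of (zip w is) x)"
    have "?f x \<in> set (map ?f w)" if "x \<in> set w" for x
      unfolding list.set_map using that by (rule imageI)
    then have "?f x \<in> X" if "x \<in> set w" for x
      using that sub unfolding inverse[OF len] by blast
    then show "?f \<in> set w \<rightarrow>\<^sub>E X" by (simp only: PiE_iff restrict_extensional) blast
  qed
qed auto

lemma fundamental_Des_eq_genseries:
  assumes "distinct w"
  shows "fundamental (Des w D) (length w) =
    genseries {f \<in> set w \<rightarrow>\<^sub>E {1..}. compatible (parcs D) w f} (content (set w))"
proof -
  have "fundamental (Des w D) (length w) =
      genseries (fundamental_indices (Des w D) (length w)) mset"
    by (simp add: fundamental_def genseries_def flip: prod_mset_prod_list)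
  also have "\<dots> = genseries {f \<in> set w \<rightarrow>\<^sub>E {1..}. compatible (parcs D) w f} (content (set w))"
  proof (rule genseries_reindex[symmetric])
    have "fundamental_indices (Des w D) (length w) =
        {is \<in> {is. length is = length w \<and> set is \<subseteq> {1..}}.
          sorted is \<and> (\<forall>p\<in>Des w D. is ! (p - 1) < is ! p)}"
      by (auto simp: fundamental_indices_def)
    then show "bij_betw (\<lambda>f. map f w) {f \<in> set w \<rightarrow>\<^sub>E {1..}. compatible (parcs D) w f}
        (fundamental_indices (Des w D) (length w))"
      using bij_betw_map_PiE[OF assms]
      by (simp only:) (rule bij_betw_Collect, simp_all add: compatible_iff_strict_at_Des)
    show "mset (map f w) = content (set w) f" for f
      using assms by (simp add: content_def mset_set_set)
  qed
  finally show ?thesis .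
qed

theorem redei_berge_signed_expansion:
  assumes V: "finite (pverts D)"
  shows "redei_berge D = (\<Sum>\<sigma> | \<sigma> permutes pverts D.
    of_int (perm_weight (parcs D) (pverts D) \<sigma>) * (\<Prod>Q\<in>orbit \<sigma> ` pverts D. powersum (card Q)))"
proof -
  let ?V = "pverts D" and ?A = "parcs D"
  let ?labellings = "?V \<rightarrow>\<^sub>E {1::nat..}"
  have "redei_berge D = (\<Sum>w\<in>permutations_of_set ?V.
      of_int 1 * genseries {f \<in> ?labellings. compatible ?A w f} (content ?V))"
    unfolding redei_berge_def
  proof (intro sum.cong refl)
    fix w assume "w \<in> permutations_of_set ?V"
    then have w: "distinct w" "set w = ?V" by (simp_all add: permutations_of_set_def)
    then have "length w = card ?V" by (metis distinct_card)
    then show "fundamental (Des w D) (card ?V) =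
        of_int 1 * genseries {f \<in> ?labellings. compatible ?A w f} (content ?V)"
      using fundamental_Des_eq_genseries[OF w(1), of D] by (simp add: w(2))
  qed
  also have "\<dots> = (\<Sum>\<sigma> | \<sigma> permutes ?V. of_int (perm_weight ?A ?V \<sigma>) *
      genseries {f \<in> ?labellings. \<forall>x\<in>?V. f (\<sigma> x) = f x} (content ?V))"
  proof (rule weighted_sum_genseries_eqI)
    fix f :: "'a \<Rightarrow> nat"
    show "(\<Sum>w | w \<in> permutations_of_set ?V \<and> compatible ?A w f. 1) =
        (\<Sum>\<sigma> | \<sigma> \<in> {\<sigma>. \<sigma> permutes ?V} \<and> (\<forall>x\<in>?V. f (\<sigma> x) = f x). perm_weight ?A ?V \<sigma>)"
      using card_compatible_listings_eq_alternating_sum[OF V, of ?A f]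
        sum_perm_weight_level_perms[OF V, of ?A f]
      by (simp add: level_perms_def)
  qed (use V in \<open>simp_all add: finite_permutations finite_fibres_content\<close>)
  also have "\<dots> = (\<Sum>\<sigma> | \<sigma> permutes ?V.
      of_int (perm_weight ?A ?V \<sigma>) * (\<Prod>Q\<in>orbit \<sigma> ` ?V. powersum (card Q)))"
    by (intro sum.cong refl arg_cong2[where f = "(*)"]) (simp add: prod_powersum_card_orbits[OF V])
  finally show ?thesis .
qed

section \<open>Cancellation by reversing a risky cycle\<close>

definition flip_on :: "'a set \<Rightarrow> ('a \<Rightarrow> 'a) \<Rightarrow> 'a \<Rightarrow> 'a" where
  "flip_on Q \<sigma> x = (if x \<in> Q then inv \<sigma> x else \<sigma> x)"

lemma perm_arcs_flip_on_disjoint: "R \<inter> Q = {} \<Longrightarrow> perm_arcs (flip_on Q \<sigma>) R = perm_arcs \<sigma> R"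
  unfolding perm_arcs_def by (intro image_cong) (auto simp: flip_on_def)

context
  fixes \<sigma> :: "'a \<Rightarrow> 'a" and Q :: "'a set"
  assumes bij: "bij \<sigma>" and invariant: "\<sigma> -` Q = Q"
begin

lemma image_mem_invariant_iff: "\<sigma> x \<in> Q \<longleftrightarrow> x \<in> Q"
  using invariant by auto

lemma inv_mem_invariant_iff: "inv \<sigma> x \<in> Q \<longleftrightarrow> x \<in> Q"
  using image_mem_invariant_iff[of "inv \<sigma> x"] by (simp add: bij surj_f_inv_f bij_is_surj)

lemma flip_on_comp_flip_on_inv: "flip_on Q \<sigma> \<circ> flip_on Q (inv \<sigma>) = id"
  using bij by (auto simp: flip_on_def fun_eq_iff image_mem_invariant_iff inv_mem_invariant_iff
      inv_inv_eq bij_is_inj bij_is_surj surj_f_inv_f)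

lemma flip_on_inv_comp_flip_on: "flip_on Q (inv \<sigma>) \<circ> flip_on Q \<sigma> = id"
  using bij by (auto simp: flip_on_def fun_eq_iff image_mem_invariant_iff inv_mem_invariant_iff
      inv_inv_eq bij_is_inj bij_is_surj surj_f_inv_f)

lemma bij_flip_on: "bij (flip_on Q \<sigma>)"
  using flip_on_inv_comp_flip_on flip_on_comp_flip_on_inv by (rule o_bij)

lemma inv_flip_on: "inv (flip_on Q \<sigma>) = flip_on Q (inv \<sigma>)"
  using flip_on_inv_comp_flip_on flip_on_comp_flip_on_inv by (rule inv_unique_comp[rotated])

lemma flip_on_flip_on: "flip_on Q (flip_on Q \<sigma>) = \<sigma>"
  by (simp add: fun_eq_iff flip_on_def[of Q "flip_on Q \<sigma>"] inv_flip_on)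
    (simp add: flip_on_def inv_inv_eq[OF bij])

lemma flip_on_permutes:
  assumes "\<sigma> permutes V"
  shows "flip_on Q \<sigma> permutes V"
  unfolding permutes_def
proof (intro conjI allI impI)
  show "\<exists>!x. flip_on Q \<sigma> x = y" for y using bij_flip_on by (simp add: bij_iff)
  show "flip_on Q \<sigma> x = x" if "x \<notin> V" for x
    using that permutes_not_in[OF assms] permutes_not_in[OF permutes_inv[OF assms]]
    by (simp add: flip_on_def)
qed

lemma orbit_flip_on:
  assumes "permutation \<sigma>"
  shows "orbit (flip_on Q \<sigma>) x = orbit \<sigma> x"
proof (cases "x \<in> Q")
  case True
  have "orbit (flip_on Q \<sigma>) x = orbit (inv \<sigma>) x"
    by (rule orbit_cong0[symmetric, where A = Q])
      (use True in \<open>auto simp: inv_mem_invariant_iff flip_on_def\<close>)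
  then show ?thesis by (simp add: orbit_inv_eq[OF assms])
next
  case False
  then show ?thesis
    by (intro orbit_cong0[symmetric, where A = "- Q"])
      (auto simp: image_mem_invariant_iff flip_on_def)
qed

lemma perm_arcs_flip_on: "perm_arcs (flip_on Q \<sigma>) Q = (perm_arcs \<sigma> Q)\<inverse>"
proof -
  have "y = inv \<sigma> x \<longleftrightarrow> x = \<sigma> y" for x y
    using bij by (metis bij_inv_eq_iff)
  then have "(x, y) \<in> perm_arcs (flip_on Q \<sigma>) Q \<longleftrightarrow> (x, y) \<in> (perm_arcs \<sigma> Q)\<inverse>" for x y
    unfolding flip_on_def perm_arcs_iff converse_iff using image_mem_invariant_iff by metis
  then show ?thesis by auto
qed

end

definition uniform_orbit :: "('a \<times> 'a) set \<Rightarrow> ('a \<Rightarrow> 'a) \<Rightarrow> 'a set \<Rightarrow> bool" where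
  "uniform_orbit A \<sigma> Q \<longleftrightarrow> perm_arcs \<sigma> Q \<subseteq> A \<or> perm_arcs \<sigma> Q \<inter> A = {}"

definition risky_orbit :: "('a \<times> 'a) set \<Rightarrow> ('a \<Rightarrow> 'a) \<Rightarrow> 'a set \<Rightarrow> bool" where
  "risky_orbit A \<sigma> Q \<longleftrightarrow>
    even (card Q) \<and> (perm_arcs \<sigma> Q \<subseteq> A \<or> (perm_arcs \<sigma> Q)\<inverse> \<subseteq> A)"

definition risky_orbits :: "('a \<times> 'a) set \<Rightarrow> 'a set \<Rightarrow> ('a \<Rightarrow> 'a) \<Rightarrow> 'a set set" where
  "risky_orbits A V \<sigma> = {Q \<in> orbit \<sigma> ` V. risky_orbit A \<sigma> Q}"

definition flip_risky :: "('a \<times> 'a) set \<Rightarrow> 'a set \<Rightarrow> ('a \<Rightarrow> 'a) \<Rightarrow> ('a \<Rightarrow> 'a)" where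
  "flip_risky A V \<sigma> = flip_on (SOME Q. Q \<in> risky_orbits A V \<sigma>) \<sigma>"

definition risk_free_perms :: "('a \<times> 'a) set \<Rightarrow> 'a set \<Rightarrow> ('a \<Rightarrow> 'a) set" where
  "risk_free_perms A V =
    {\<sigma>. \<sigma> permutes V \<and> (\<forall>Q\<in>orbit \<sigma> ` V. uniform_orbit A \<sigma> Q \<and> \<not> risky_orbit A \<sigma> Q)}"

lemma antisym_converse:
  assumes "antisym A" "P \<subseteq> A" "P \<inter> Id = {}" "P \<noteq> {}"
  shows "P\<inverse> \<inter> A = {}" "\<not> P\<inverse> \<subseteq> A"
proof -
  show "P\<inverse> \<inter> A = {}" using assms(1-3) by (auto dest: antisymD)
  with assms(4) show "\<not> P\<inverse> \<subseteq> A" by auto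
qed

lemma orbit_weight_converse_arcs:
  assumes A: "antisym A" and "even (card Q)" "Q \<noteq> {}" and irrefl: "perm_arcs \<sigma> Q \<inter> Id = {}"
    and \<tau>: "perm_arcs \<tau> Q = (perm_arcs \<sigma> Q)\<inverse>"
    and risky: "perm_arcs \<sigma> Q \<subseteq> A \<or> (perm_arcs \<sigma> Q)\<inverse> \<subseteq> A"
  shows "orbit_weight A \<tau> Q = - orbit_weight A \<sigma> Q"
proof -
  have forward: "perm_arcs \<sigma> Q \<noteq> {}" using assms(3) by (simp add: perm_arcs_def)
  have backward: "(perm_arcs \<sigma> Q)\<inverse> \<inter> Id = {}"
    using irrefl by (metis converse_Id converse_Int converse_empty)
  have backward_nonempty: "(perm_arcs \<sigma> Q)\<inverse> \<noteq> {}"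
    using forward by (metis converse_converse converse_empty)
  from risky show ?thesis
  proof
    assume "perm_arcs \<sigma> Q \<subseteq> A"
    with antisym_converse[OF A this irrefl forward] show ?thesis
      using \<open>even (card Q)\<close> by (simp add: orbit_weight_def \<tau>)
  next
    assume "(perm_arcs \<sigma> Q)\<inverse> \<subseteq> A"
    with antisym_converse[OF A this backward backward_nonempty] show ?thesis
      using \<open>even (card Q)\<close> by (simp add: orbit_weight_def \<tau>)
  qed
qed

context
  fixes V :: "'a set" and \<sigma> :: "'a \<Rightarrow> 'a" and Q :: "'a set"
  assumes V: "finite V" and \<sigma>: "\<sigma> permutes V" and Q: "Q \<in> orbit \<sigma> ` V"
begin

lemma vimage_orbit: "\<sigma> -` Q = Q"
proof -
  have perm: "permutation \<sigma>" using V \<sigma> by (rule permutes_imp_permutation)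
  then have "\<sigma> x \<in> Q \<longleftrightarrow> x \<in> Q" for x
    using Q orbit_eq_if_mem[OF perm] permutation_self_in_orbit[OF perm]
      permutation_orbit_step[OF perm] by (metis imageE)
  then show ?thesis by auto
qed

lemma flip_on_orbit_flip_on: "flip_on Q (flip_on Q \<sigma>) = \<sigma>"
  using permutes_bij[OF \<sigma>] vimage_orbit by (rule flip_on_flip_on)

lemma flip_on_orbit_permutes: "flip_on Q \<sigma> permutes V"
  using permutes_bij[OF \<sigma>] vimage_orbit \<sigma> by (rule flip_on_permutes)

lemma orbits_flip_on: "orbit (flip_on Q \<sigma>) ` V = orbit \<sigma> ` V"
  using orbit_flip_on[OF permutes_bij[OF \<sigma>] vimage_orbit permutes_imp_permutation[OF V \<sigma>]]
  by simp

lemma perm_arcs_flip_on_orbit: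
  assumes "R \<in> orbit \<sigma> ` V"
  shows "perm_arcs (flip_on Q \<sigma>) R = (if R = Q then (perm_arcs \<sigma> Q)\<inverse> else perm_arcs \<sigma> R)"
proof (cases "R = Q")
  case True
  then show ?thesis by (simp add: perm_arcs_flip_on[OF permutes_bij[OF \<sigma>] vimage_orbit])
next
  case False
  have "disjoint (orbit \<sigma> ` V)" using partition_on_orbits[OF V \<sigma>] by (rule partition_onD2)
  from disjointD[OF this assms Q False] show ?thesis
    using False by (simp add: perm_arcs_flip_on_disjoint)
qed

lemma risky_orbits_flip_on: "risky_orbits A V (flip_on Q \<sigma>) = risky_orbits A V \<sigma>"
proof -
  have "risky_orbit A (flip_on Q \<sigma>) R \<longleftrightarrow> risky_orbit A \<sigma> R" if "R \<in> orbit \<sigma> ` V" for R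
    unfolding risky_orbit_def perm_arcs_flip_on_orbit[OF that] by (simp add: disj_commute)
  then show ?thesis unfolding risky_orbits_def orbits_flip_on by blast
qed

lemma perm_weight_flip_on:
  assumes A: "antisym A" and risky: "risky_orbit A \<sigma> Q"
  shows "perm_weight A V (flip_on Q \<sigma>) = - perm_weight A V \<sigma>"
proof -
  have "(x, x) \<notin> perm_arcs \<sigma> Q" for x
  proof
    assume "(x, x) \<in> perm_arcs \<sigma> Q"
    then have "x \<in> Q" "\<sigma> x = x" by auto
    then have "orbit \<sigma> x = {x}" by (simp add: orbit_eq_singleton_iff)
    moreover have "orbit \<sigma> x = Q"
      using Q \<open>x \<in> Q\<close> orbit_eq_if_mem[OF permutes_imp_permutation[OF V \<sigma>]] by auto
    ultimately show False using risky by (auto simp: risky_orbit_def)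
  qed
  then have "orbit_weight A (flip_on Q \<sigma>) Q = - orbit_weight A \<sigma> Q"
    using A risky Q
    by (intro orbit_weight_converse_arcs)
      (auto simp: risky_orbit_def perm_arcs_flip_on_orbit orbit_nonempty)
  moreover have "(\<Prod>R\<in>orbit \<sigma> ` V - {Q}. orbit_weight A (flip_on Q \<sigma>) R) =
      (\<Prod>R\<in>orbit \<sigma> ` V - {Q}. orbit_weight A \<sigma> R)"
    by (intro prod.cong refl) (simp add: orbit_weight_def perm_arcs_flip_on_orbit)
  ultimately show ?thesis
    unfolding perm_weight_def orbits_flip_on using V Q by (simp add: prod.remove[of _ Q])
qed

end

lemma perm_weight_without_risky_orbits:
  assumes "finite V" "\<sigma> permutes V" "risky_orbits A V \<sigma> = {}"
  shows "perm_weight A V \<sigma> = (if \<sigma> \<in> risk_free_perms A V then 1 else 0)"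
proof -
  have weight: "orbit_weight A \<sigma> Q = (if uniform_orbit A \<sigma> Q then 1 else 0)"
    if "Q \<in> orbit \<sigma> ` V" for Q
  proof -
    have "\<not> risky_orbit A \<sigma> Q" using that assms(3) by (auto simp: risky_orbits_def)
    then show ?thesis by (auto simp: orbit_weight_def uniform_orbit_def risky_orbit_def)
  qed
  show ?thesis
  proof (cases "\<sigma> \<in> risk_free_perms A V")
    case True
    then have "orbit_weight A \<sigma> Q = 1" if "Q \<in> orbit \<sigma> ` V" for Q
      unfolding weight[OF that] using that by (auto simp: risk_free_perms_def)
    then show ?thesis using True by (simp add: perm_weight_def)
  next
    case False
    then obtain Q where Q: "Q \<in> orbit \<sigma> ` V" "\<not> uniform_orbit A \<sigma> Q"
      using assms(2,3) unfolding risk_free_perms_def risky_orbits_def by blast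
    then have "orbit_weight A \<sigma> Q = 0" using weight[OF Q(1)] by simp
    then show ?thesis using False Q(1) assms(1) by (auto simp: perm_weight_def prod_zero_iff)
  qed
qed

lemma flip_risky_involution:
  assumes V: "finite V" and A: "antisym A"
    and \<sigma>: "\<sigma> permutes V" and risky: "risky_orbits A V \<sigma> \<noteq> {}"
  shows "flip_risky A V \<sigma> permutes V"
    and "risky_orbits A V (flip_risky A V \<sigma>) = risky_orbits A V \<sigma>"
    and "flip_risky A V (flip_risky A V \<sigma>) = \<sigma>"
    and "orbit (flip_risky A V \<sigma>) ` V = orbit \<sigma> ` V"
    and "perm_weight A V (flip_risky A V \<sigma>) = - perm_weight A V \<sigma>"
proof -
  define Q where "Q = (SOME Q. Q \<in> risky_orbits A V \<sigma>)"
  have "Q \<in> risky_orbits A V \<sigma>" using risky by (simp add: Q_def some_in_eq)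
  then have Q: "Q \<in> orbit \<sigma> ` V" "risky_orbit A \<sigma> Q" by (auto simp: risky_orbits_def)
  have flip: "flip_risky A V \<sigma> = flip_on Q \<sigma>" by (simp add: flip_risky_def Q_def)
  show "flip_risky A V \<sigma> permutes V" "orbit (flip_risky A V \<sigma>) ` V = orbit \<sigma> ` V"
    "perm_weight A V (flip_risky A V \<sigma>) = - perm_weight A V \<sigma>"
    unfolding flip
    by (rule flip_on_orbit_permutes[OF V \<sigma> Q(1)] orbits_flip_on[OF V \<sigma> Q(1)]
        perm_weight_flip_on[OF V \<sigma> Q(1) A Q(2)])+
  \<comment> \<open>The set of risky orbits determines the choice of \<open>Q\<close>, so the second flip undoes the first.\<close>
  show same: "risky_orbits A V (flip_risky A V \<sigma>) = risky_orbits A V \<sigma>"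
    unfolding flip by (rule risky_orbits_flip_on[OF V \<sigma> Q(1)])
  have "flip_risky A V (flip_risky A V \<sigma>) = flip_on Q (flip_on Q \<sigma>)"
    unfolding flip_risky_def[of A V "flip_risky A V \<sigma>"] same by (simp add: flip flip: Q_def)
  also have "\<dots> = \<sigma>" by (rule flip_on_orbit_flip_on[OF V \<sigma> Q(1)])
  finally show "flip_risky A V (flip_risky A V \<sigma>) = \<sigma>" .
qed

theorem sum_perm_weight_antisym:
  fixes F :: "'a set set \<Rightarrow> ('v, int) mfps"
  assumes V: "finite V" and A: "antisym A"
  shows "(\<Sum>\<sigma> | \<sigma> permutes V. of_int (perm_weight A V \<sigma>) * F (orbit \<sigma> ` V)) =
    (\<Sum>\<sigma>\<in>risk_free_perms A V. F (orbit \<sigma> ` V))"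
proof -
  let ?term = "\<lambda>\<sigma>. of_int (perm_weight A V \<sigma>) * F (orbit \<sigma> ` V)"
  define X where "X = {\<sigma>. \<sigma> permutes V \<and> risky_orbits A V \<sigma> \<noteq> {}}"
  define Y where "Y = {\<sigma>. \<sigma> permutes V \<and> risky_orbits A V \<sigma> = {}}"
  have fin: "finite X" "finite Y"
    using finite_permutations[OF V] by (auto simp: X_def Y_def)
  have "(\<Sum>\<sigma>\<in>X. ?term \<sigma>) = (\<Sum>\<sigma>\<in>X. - ?term \<sigma>)"
    by (rule sum.reindex_bij_witness[where i = "flip_risky A V" and j = "flip_risky A V"])
      (auto simp: X_def flip_risky_involution[OF V A])
  then have cancel: "(\<Sum>\<sigma>\<in>X. ?term \<sigma>) = 0"
    unfolding sum_negf by (rule mfps_eq_uminus_self_iff[THEN iffD1])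
  have "{\<sigma>. \<sigma> permutes V} = X \<union> Y" "X \<inter> Y = {}" by (auto simp: X_def Y_def)
  with fin cancel have "(\<Sum>\<sigma> | \<sigma> permutes V. ?term \<sigma>) = (\<Sum>\<sigma>\<in>Y. ?term \<sigma>)"
    by (simp add: sum.union_disjoint)
  also have "\<dots> = (\<Sum>\<sigma>\<in>risk_free_perms A V. F (orbit \<sigma> ` V))"
  proof (intro sum.mono_neutral_cong_right)
    show sub: "risk_free_perms A V \<subseteq> Y" by (auto simp: risk_free_perms_def risky_orbits_def Y_def)
    have "perm_weight A V \<sigma> = (if \<sigma> \<in> risk_free_perms A V then 1 else 0)" if "\<sigma> \<in> Y" for \<sigma>
      using that by (intro perm_weight_without_risky_orbits V) (auto simp: Y_def)
    then show "\<forall>\<sigma>\<in>Y - risk_free_perms A V. ?term \<sigma> = 0"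
      "\<And>\<sigma>. \<sigma> \<in> risk_free_perms A V \<Longrightarrow> ?term \<sigma> = F (orbit \<sigma> ` V)"
      using sub by auto
  qed (rule fin)
  finally show ?thesis .
qed

section \<open>Cycles and orbits\<close>

lemma rot_class_rotate:
  assumes "v \<noteq> []"
  shows "rot_class (rotate k v) = rot_class v"
proof -
  have "(v, rotate k v) \<in> rot_equiv" using assms by (auto simp: rot_equiv_def)
  then show ?thesis
    unfolding rot_class_def by (rule equiv_class_eq[OF equiv_rot_equiv, symmetric])
qed

lemma set_rot_rep_rot_class: "v \<noteq> [] \<Longrightarrow> set (rot_rep (rot_class v)) = set v"
  using rot_rep_rot_class[of v] by (auto simp: rot_equiv_def)

lemma CArcs_rot_class_rev:
  assumes "v \<noteq> []"
  shows "CArcs (rot_class (rev v)) = (CArcs (rot_class v))\<inverse>"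
proof -
  have rotate1_rev: "rotate1 (rev (rotate1 v)) = rev v" by (cases v) auto
  have "rot_class (rev v) = rot_class (rev (rotate1 v))"
    using rot_class_rotate[of "rev (rotate1 v)" 1] rotate1_rev assms by simp
  then have "CArcs (rot_class (rev v)) = set (zip (rev (rotate1 v)) (rev v))"
    using CArcs_rot_class[of "rev (rotate1 v)"] rotate1_rev assms by simp
  also have "\<dots> = set (zip (rotate1 v) v)"
    by (simp add: zip_rev)
  also have "\<dots> = (set (zip v (rotate1 v)))\<inverse>"
    by (auto simp: set_zip)
  finally show ?thesis by (simp add: CArcs_rot_class assms)
qed

lemma is_digraph_cycle_rot_class_iff:
  assumes "v \<noteq> []" "distinct v" "set v \<subseteq> pverts D"
  shows "is_digraph_cycle D (rot_class v) \<longleftrightarrow> CArcs (rot_class v) \<subseteq> parcs D"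
  using assms by (auto simp: is_digraph_cycle_def)

context
  fixes \<sigma> :: "'a \<Rightarrow> 'a"
  assumes perm: "permutation \<sigma>"
begin

lemma support_nonempty: "support \<sigma> i \<noteq> []"
  using least_power_of_permutation(2)[OF perm, of i] by simp

lemma set_support: "set (support \<sigma> i) = orbit \<sigma> i"
  unfolding support_set[OF perm] orbit_altdef_permutation[OF perm] by auto

lemma length_support: "length (support \<sigma> i) = card (orbit \<sigma> i)"
  using distinct_card[OF cycle_of_permutation[OF perm, of i]] unfolding set_support by simp

lemma support_funpow: "support \<sigma> ((\<sigma> ^^ k) i) = rotate k (support \<sigma> i)"
proof -
  have "(\<sigma> ^^ k) i \<in> orbit \<sigma> i"
    by (rule funpow_in_orbit[OF permutation_self_in_orbit[OF perm]])
  then have len: "least_power \<sigma> ((\<sigma> ^^ k) i) = least_power \<sigma> i"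
    using length_support[of i] length_support[of "(\<sigma> ^^ k) i"] orbit_eq_if_mem[OF perm] by simp
  show ?thesis
  proof (rule nth_equalityI)
    fix n assume "n < length (support \<sigma> ((\<sigma> ^^ k) i))"
    then have n: "n < least_power \<sigma> i" by (simp add: len)
    have "(\<sigma> ^^ ((k + n) mod least_power \<sigma> i)) i = (\<sigma> ^^ (k + n)) i"
      using least_power_of_permutation[OF perm, of i] by (simp add: funpow_mod_eq)
    then show "support \<sigma> ((\<sigma> ^^ k) i) ! n = rotate k (support \<sigma> i) ! n"
      using n by (simp add: len nth_rotate funpow_add add.commute[of k])
  qed (simp add: len)
qed

lemma rot_class_support_eq:
  assumes "orbit \<sigma> i = orbit \<sigma> j"
  shows "rot_class (support \<sigma> i) = rot_class (support \<sigma> j)"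
proof -
  have "i \<in> orbit \<sigma> j" using assms permutation_self_in_orbit[OF perm] by blast
  then obtain k where i: "i = (\<sigma> ^^ k) j" unfolding orbit_altdef by blast
  show ?thesis unfolding i support_funpow by (rule rot_class_rotate[OF support_nonempty])
qed

lemma set_rot_rep_support: "set (rot_rep (rot_class (support \<sigma> i))) = orbit \<sigma> i"
  unfolding set_rot_rep_rot_class[OF support_nonempty] by (rule set_support)

lemma rot_length_support: "rot_length (rot_class (support \<sigma> i)) = card (orbit \<sigma> i)"
  unfolding rot_length_rot_class[OF support_nonempty] by (rule length_support)

lemma prod_perm_cycles:
  fixes F :: "nat \<Rightarrow> 'b :: comm_monoid_mult"
  shows "(\<Prod>\<gamma>\<in>perm_cycles V \<sigma>. F (rot_length \<gamma>)) = (\<Prod>Q\<in>orbit \<sigma> ` V. F (card Q))"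
proof (rule prod.reindex_cong[symmetric])
  show "inj_on (\<lambda>\<gamma>. set (rot_rep \<gamma>)) (perm_cycles V \<sigma>)"
    unfolding perm_cycles_def
    by (intro inj_onI) (clarsimp simp: set_rot_rep_support, erule rot_class_support_eq)
  show "orbit \<sigma> ` V = (\<lambda>\<gamma>. set (rot_rep \<gamma>)) ` perm_cycles V \<sigma>"
    unfolding perm_cycles_def by (simp add: image_image set_rot_rep_support)
  show "F (card (set (rot_rep \<gamma>))) = F (rot_length \<gamma>)" if "\<gamma> \<in> perm_cycles V \<sigma>" for \<gamma>
    using that unfolding perm_cycles_def by (auto simp: set_rot_rep_support rot_length_support)
qed

lemma CArcs_support: "CArcs (rot_class (support \<sigma> i)) = perm_arcs \<sigma> (orbit \<sigma> i)"
proof -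
  have "rotate1 (support \<sigma> i) = support \<sigma> (\<sigma> i)"
    using support_funpow[of 1 i] by simp
  also have "\<dots> = map \<sigma> (support \<sigma> i)"
    using length_support[of i] length_support[of "\<sigma> i"] permutation_orbit_step[OF perm, of i]
    by (simp add: funpow_swap1)
  finally have "CArcs (rot_class (support \<sigma> i)) = set (zip (support \<sigma> i) (map \<sigma> (support \<sigma> i)))"
    by (simp only: CArcs_rot_class[OF support_nonempty])
  also have "\<dots> = perm_arcs \<sigma> (set (support \<sigma> i))"
    by (simp only: perm_arcs_def zip_map2 zip_same_conv_map) (simp add: image_image)
  finally show ?thesis unfolding set_support .
qed

context
  fixes D :: "'a pair_pre_digraph" and i :: 'a
  assumes orbit_subset: "orbit \<sigma> i \<subseteq> pverts D"
begin

lemma is_digraph_cycle_support_iff: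
  "is_digraph_cycle D (rot_class (support \<sigma> i)) \<longleftrightarrow> perm_arcs \<sigma> (orbit \<sigma> i) \<subseteq> parcs D"
  unfolding CArcs_support[symmetric]
  by (rule is_digraph_cycle_rot_class_iff[OF support_nonempty cycle_of_permutation[OF perm]])
    (unfold set_support, rule orbit_subset)

lemma is_digraph_cycle_reversal_support_iff:
  "is_digraph_cycle D (rot_reversal (rot_class (support \<sigma> i))) \<longleftrightarrow>
    (perm_arcs \<sigma> (orbit \<sigma> i))\<inverse> \<subseteq> parcs D"
  unfolding CArcs_support[symmetric] CArcs_rot_class_rev[OF support_nonempty, symmetric]
    rot_reversal_rot_class[OF support_nonempty]
  by (rule is_digraph_cycle_rot_class_iff)
    (use support_nonempty cycle_of_permutation[OF perm] set_support orbit_subset in simp_all)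

lemma risky_support_iff:
  "risky D (rot_class (support \<sigma> i)) \<longleftrightarrow> risky_orbit (parcs D) \<sigma> (orbit \<sigma> i)"
  unfolding risky_def risky_orbit_def rot_length_support
    is_digraph_cycle_support_iff is_digraph_cycle_reversal_support_iff ..

end

lemma uniform_orbit_iff_is_digraph_cycle_support:
  assumes "orbit \<sigma> i \<subseteq> pverts D"
  shows "uniform_orbit (parcs D) \<sigma> (orbit \<sigma> i) \<longleftrightarrow>
    is_digraph_cycle D (rot_class (support \<sigma> i)) \<or>
    is_digraph_cycle (complement_digraph D) (rot_class (support \<sigma> i))"
proof -
  have "\<sigma> x \<in> orbit \<sigma> i" if "x \<in> orbit \<sigma> i" for x using that by (rule orbit.step)
  then have "perm_arcs \<sigma> (orbit \<sigma> i) \<subseteq> pverts D \<times> pverts D"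
    using assms by auto
  moreover have "orbit \<sigma> i \<subseteq> pverts (complement_digraph D)"
    using assms by (simp add: complement_digraph_def)
  ultimately have "is_digraph_cycle (complement_digraph D) (rot_class (support \<sigma> i)) \<longleftrightarrow>
      perm_arcs \<sigma> (orbit \<sigma> i) \<inter> parcs D = {}"
    unfolding is_digraph_cycle_support_iff[OF \<open>orbit \<sigma> i \<subseteq> pverts (complement_digraph D)\<close>]
    by (auto simp: complement_digraph_def)
  then show ?thesis
    unfolding uniform_orbit_def is_digraph_cycle_support_iff[OF assms] by simp
qed

end

lemma powersum_partition_perm_type:
  assumes "finite V" "\<sigma> permutes V"
  shows "powersum_partition (perm_type V \<sigma>) = (\<Prod>Q\<in>orbit \<sigma> ` V. powersum (card Q))"
  using prod_perm_cycles[OF permutes_imp_permutation[OF assms], of powersum V]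
  by (simp add: powersum_partition_def perm_type_def image_mset.compositionality comp_def
      flip: prod_unfold_prod_mset)

lemma risk_free_cycle_perms:
  assumes V: "finite (pverts D)"
  shows "{\<sigma> \<in> cycle_perms D. \<forall>\<gamma>\<in>perm_cycles (pverts D) \<sigma>. \<not> risky D \<gamma>} =
    risk_free_perms (parcs D) (pverts D)"
proof (rule set_eqI)
  fix \<sigma>
  show "\<sigma> \<in> {\<sigma> \<in> cycle_perms D. \<forall>\<gamma>\<in>perm_cycles (pverts D) \<sigma>. \<not> risky D \<gamma>} \<longleftrightarrow>
      \<sigma> \<in> risk_free_perms (parcs D) (pverts D)"
  proof (cases "\<sigma> permutes pverts D")
    case True
    have perm: "permutation \<sigma>" using V True by (rule permutes_imp_permutation)
    have "orbit \<sigma> i \<subseteq> pverts D" if "i \<in> pverts D" for i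
      using True that by (rule permutes_orbit_subset)
    then show ?thesis
      using True
      by (auto simp: cycle_perms_def risk_free_perms_def perm_cycles_def
          uniform_orbit_iff_is_digraph_cycle_support[OF perm] risky_support_iff[OF perm])
  qed (simp add: cycle_perms_def risk_free_perms_def)
qed

lemma sum_mem_powersum_semiring:
  "(\<And>x. x \<in> S \<Longrightarrow> F x \<in> powersum_semiring) \<Longrightarrow> (\<Sum>x\<in>S. F x) \<in> powersum_semiring"
  by (induction S rule: infinite_finite_induct) (auto intro: powersum_semiring.intros)

lemma prod_mem_powersum_semiring:
  "(\<And>x. x \<in> S \<Longrightarrow> F x \<in> powersum_semiring) \<Longrightarrow> (\<Prod>x\<in>S. F x) \<in> powersum_semiring"
  by (induction S rule: infinite_finite_induct) (auto intro: powersum_semiring.intros)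

lemma powersum_partition_perm_type_mem_powersum_semiring:
  assumes "finite V" "\<sigma> permutes V"
  shows "powersum_partition (perm_type V \<sigma>) \<in> powersum_semiring"
  unfolding powersum_partition_perm_type[OF assms]
proof (intro prod_mem_powersum_semiring powersum_semiring.gen)
  have perm: "permutation \<sigma>" using assms by (rule permutes_imp_permutation)
  show "1 \<le> card Q" if "Q \<in> orbit \<sigma> ` V" for Q
    using that finite_orbit_permutation[OF perm]
    by (auto simp: Suc_le_eq card_gt_0_iff orbit_nonempty)
qed

theorem theorem1p41:
  fixes D :: "'a pair_pre_digraph"
  assumes "pair_fin_digraph D"
    and "\<not> (\<exists>u\<in>pverts D. \<exists>v\<in>pverts D. u \<noteq> v \<and> (u, v) \<in> parcs D \<and> (v, u) \<in> parcs D)"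
  shows "redei_berge D \<in> powersum_semiring \<and>
    redei_berge D =
      (\<Sum>\<sigma>\<in>{\<sigma> \<in> cycle_perms D. \<forall>\<gamma>\<in>perm_cycles (pverts D) \<sigma>. \<not> risky D \<gamma>}.
        powersum_partition (perm_type (pverts D) \<sigma>))"
proof -
  interpret pair_fin_digraph D by fact
  let ?V = "pverts D"
  have V: "finite ?V" by (rule pair_finite_verts)
  have antisym: "antisym (parcs D)"
    using assms(2) in_arcsD1 by (blast intro: antisymI)
  have "redei_berge D =
      (\<Sum>\<sigma>\<in>risk_free_perms (parcs D) ?V. \<Prod>Q\<in>orbit \<sigma> ` ?V. powersum (card Q))"
    unfolding redei_berge_signed_expansion[OF V] by (rule sum_perm_weight_antisym[OF V antisym])
  also have "\<dots> = (\<Sum>\<sigma>\<in>risk_free_perms (parcs D) ?V. powersum_partition (perm_type ?V \<sigma>))"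
    using V by (intro sum.cong refl) (simp add: risk_free_perms_def powersum_partition_perm_type)
  finally have expansion: "redei_berge D =
      (\<Sum>\<sigma>\<in>risk_free_perms (parcs D) ?V. powersum_partition (perm_type ?V \<sigma>))" .
  also have "\<dots> \<in> powersum_semiring"
    using V by (intro sum_mem_powersum_semiring powersum_partition_perm_type_mem_powersum_semiring)
      (simp_all add: risk_free_perms_def)
  finally show ?thesis
    using expansion by (simp only: risk_free_cycle_perms[OF V])
qed

end
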